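(* There exists an absolute constant $C>0$ such that the following holds. Let $n\ge 1$, let $(p_{ij})_{i,j=1}^n$ be a symmetric matrix with entries in $[0,1]$, and let $A$ be the adjacency matrix of an inhomogeneous random graph $G(n,(p_{ij}))$. Then $$ \mathbb{E}\,\|A-\mathbb{E}A\| \le C\left(\sqrt{d}+\sqrt{\log n}\right),\qquad \text{where } d=\max_{1\le i\le n}\sum_{j=1}^n p_{ij} $$ is the maximal expected degree.
   Context: The inhomogeneous Erdős–Rényi random graph $G(n,(p_{ij}))$ is the random undirected graph on the vertex set $\{1,\dots,n\}$ in which edges are drawn independently and vertices $i$ and $j$ are connected with probability $p_{ij}=p_{ji}$. Its adjacency matrix $A$ is the symmetric $n\times n$ matrix with $A_{ij}=1$ if $i$ and $j$ are connected by an edge and $A_{ij}=0$ otherwise; thus the entries of $A$ on and above the diagonal are independent, $A_{ij}\sim\mathrm{Bernoulli}(p_{ij})$, and $\mathbb{E}A=(p_{ij})$. (If self-loops are excluded, then $A_{ii}=0$ and $p_{ii}=0$ for all $i$.) The norm $\|\cdot\|$ is the spectral (operator $\ell_2\to\ell_2$) norm. *)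

theory Defs
  imports "HOL-Probability.Probability"
begin

text \<open>
  The constant in the theorem must not depend on \<open>n\<close>, so \<open>n\<close> is quantified inside the
  formula and cannot be a type. Hence an \<open>n \<times> n\<close> matrix is a function
  \<open>nat \<Rightarrow> nat \<Rightarrow> real\<close> and a vector a function \<open>nat \<Rightarrow> real\<close>; only their values
  on \<open>{1..n}\<close> matter.
\<close>

definition spectral_norm :: "nat \<Rightarrow> (nat \<Rightarrow> nat \<Rightarrow> real) \<Rightarrow> real" where
  "spectral_norm n M =
     (SUP x \<in> {x :: nat \<Rightarrow> real. L2_set x {1..n} \<le> 1}.
        L2_set (\<lambda>i. \<Sum>j=1..n. M i j * x j) {1..n})"

text \<open>
  A graph on \<open>{1..n}\<close> is represented by its symmetric edge relation; a pair \<open>(i, i)\<close> is a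
  self-loop. Each unordered pair is represented by the ordered pair \<open>(i, j)\<close> with
  \<open>i \<le> j\<close>, for which one independent Bernoulli variable is drawn. The default value
  \<open>False\<close> of the product distribution means that there are no edges outside \<open>{1..n}\<close>.
\<close>

definition inhom_random_graph :: "nat \<Rightarrow> (nat \<Rightarrow> nat \<Rightarrow> real) \<Rightarrow> (nat \<times> nat) set pmf" where
  "inhom_random_graph n p =
     map_pmf (\<lambda>X. {(i, j). X (min i j, max i j)})
       (Pi_pmf {(i, j). 1 \<le> i \<and> i \<le> j \<and> j \<le> n} False (\<lambda>(i, j). bernoulli_pmf (p i j)))"

definition adjacency :: "(nat \<times> nat) set \<Rightarrow> nat \<Rightarrow> nat \<Rightarrow> real" where
  "adjacency G i j = (if (i, j) \<in> G then 1 else 0)"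

definition mean_adjacency :: "nat \<Rightarrow> (nat \<Rightarrow> nat \<Rightarrow> real) \<Rightarrow> nat \<Rightarrow> nat \<Rightarrow> real" where
  "mean_adjacency n p i j =
     measure_pmf.expectation (inhom_random_graph n p) (\<lambda>G. adjacency G i j)"

definition max_expected_degree :: "nat \<Rightarrow> (nat \<Rightarrow> nat \<Rightarrow> real) \<Rightarrow> real" where
  "max_expected_degree n p = Max ((\<lambda>i. \<Sum>j=1..n. p i j) ` {1..n})"

lemma spectral_norm_eq_onorm:
  fixes f :: "'n::finite \<Rightarrow> nat"
  assumes f: "bij_betw f UNIV {1..n}"
  shows "spectral_norm n M = onorm (\<lambda>x :: real ^ 'n. (\<chi> i j. M (f i) (f j)) *v x)"
proof -
  define B :: "real ^ 'n ^ 'n" where "B = (\<chi> i j. M (f i) (f j))"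
  have L2: "L2_set x {1..n} = norm (\<chi> i. x (f i))" for x :: "nat \<Rightarrow> real"
    using sum.reindex_bij_betw[OF f, of "\<lambda>i. (x i)\<^sup>2"]
    by (simp add: L2_set_def norm_vec_def)
  have Bx: "(\<chi> i. \<Sum>j=1..n. M (f i) j * x j) = B *v (\<chi> i. x (f i))" for x :: "nat \<Rightarrow> real"
    using sum.reindex_bij_betw[OF f, of "\<lambda>j. M (f i) j * x j" for i]
    by (simp add: vec_eq_iff B_def matrix_vector_mult_def)
  have key: "L2_set (\<lambda>i. \<Sum>j=1..n. M i j * x j) {1..n} = norm (B *v (\<chi> i. x (f i)))"
    for x :: "nat \<Rightarrow> real"
    by (simp only: L2 Bx)
  have surj: "\<exists>x. (\<chi> i. x (f i)) = y" for y :: "real ^ 'n"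
    by (rule exI[of _ "\<lambda>k. y $ inv f k"])
       (use f in \<open>simp add: vec_eq_iff bij_betw_def\<close>)
  have "(\<lambda>x. L2_set (\<lambda>i. \<Sum>j=1..n. M i j * x j) {1..n}) ` {x. L2_set x {1..n} \<le> 1}
      = (\<lambda>y. norm (B *v y)) ` {y. norm y \<le> 1}" (is "?l = ?r")
  proof
    show "?l \<subseteq> ?r"
    proof
      fix z assume "z \<in> ?l"
      then obtain x where x: "z = L2_set (\<lambda>i. \<Sum>j=1..n. M i j * x j) {1..n}" "L2_set x {1..n} \<le> 1"
        by blast
      show "z \<in> ?r"
        by (rule image_eqI[of _ _ "\<chi> i. x (f i)"]) (use x in \<open>simp_all only: key L2 mem_Collect_eq\<close>)
    qed
    show "?r \<subseteq> ?l"
    proof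
      fix z assume "z \<in> ?r"
      then obtain y where y: "z = norm (B *v y)" "norm y \<le> 1" by auto
      obtain x where "(\<chi> i. x (f i)) = y" using surj by blast
      then show "z \<in> ?l"
        by (intro image_eqI[of _ _ x]) (use y in \<open>simp_all only: key L2 mem_Collect_eq\<close>)
    qed
  qed
  then have eq: "spectral_norm n M = (SUP y \<in> {y. norm y \<le> 1}. norm (B *v y))"
    by (simp add: spectral_norm_def)
  have bl: "bounded_linear ((*v) B)" by (rule matrix_vector_mul_bounded_linear)
  have le: "norm (B *v y) \<le> onorm ((*v) B)" if "norm y \<le> 1" for y
    using onorm[OF bl, of y] mult_left_mono[OF that onorm_pos_le[OF bl]] by simp
  have "(SUP y \<in> {y. norm y \<le> 1}. norm (B *v y)) = onorm ((*v) B)"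
  proof (rule antisym)
    show "(SUP y \<in> {y. norm y \<le> 1}. norm (B *v y)) \<le> onorm ((*v) B)"
      by (rule cSUP_least) (use le in \<open>auto intro: exI[of _ 0]\<close>)
    have up: "norm (B *v u) \<le> (SUP y \<in> {y. norm y \<le> 1}. norm (B *v y))" if "norm u \<le> 1" for u
      by (rule cSUP_upper) (use that le in \<open>auto intro!: bdd_aboveI\<close>)
    show "onorm ((*v) B) \<le> (SUP y \<in> {y. norm y \<le> 1}. norm (B *v y))"
    proof (rule onorm_le)
      fix x
      show "norm (B *v x) \<le> (SUP y \<in> {y. norm y \<le> 1}. norm (B *v y)) * norm x"
        using up[of "x /\<^sub>R norm x"]
        by (cases "x = 0")
           (auto simp: matrix_vector_mult_scaleR divide_simps mult.commute)
    qed
  qed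
  with eq show ?thesis by (simp add: B_def)
qed

lemma mean_adjacency_eq:
  assumes "\<forall>i\<in>{1..n}. \<forall>j\<in>{1..n}. 0 \<le> p i j \<and> p i j \<le> 1 \<and> p i j = p j i"
    and "i \<in> {1..n}" "j \<in> {1..n}"
  shows "mean_adjacency n p i j = p i j"
proof -
  let ?E = "{(i, j). 1 \<le> i \<and> i \<le> j \<and> j \<le> n}"
  let ?b = "\<lambda>(i, j). bernoulli_pmf (p i j)"
  have fin: "finite ?E"
    by (rule finite_subset[of _ "{1..n} \<times> {1..n}"]) auto
  have pm: "p (min i j) (max i j) = p i j"
    using assms by (auto simp: min_def max_def)
  have "mean_adjacency n p i j
      = measure_pmf.expectation (Pi_pmf ?E False ?b) (\<lambda>X. of_bool (X (min i j, max i j)))"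
    by (simp add: mean_adjacency_def inhom_random_graph_def adjacency_def of_bool_def)
  also have "\<dots> = measure_pmf.expectation
      (map_pmf (\<lambda>X. X (min i j, max i j)) (Pi_pmf ?E False ?b)) of_bool"
    by simp
  also have "\<dots> = measure_pmf.expectation (bernoulli_pmf (p i j)) of_bool"
    by (subst Pi_pmf_component[OF fin]) (use assms pm in auto)
  also have "\<dots> = p i j"
    using assms by simp
  finally show ?thesis .
qed

end

theory Submission
  imports Defs
begin

text \<open>
  The proof is a moment computation, in which a sparse inhomogeneous matrix is compared with a
  dense homogeneous one whose size is adapted to \<open>d\<close> and \<open>log n\<close>.

  Let \<open>M = A - EA\<close>. For \<open>N\<close> a power of two, \<open>\<parallel>M\<parallel>\<^sup>2\<^sup>N\<close> is at most the trace of \<open>M\<^sup>2\<^sup>N\<close>, and the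
  expected trace is a sum over closed walks of products of moments of centred Bernoulli
  variables, one for each edge, whose order is the number of times the walk uses that edge. Such a
  moment vanishes at order one and is at most \<open>p\<^sub>i\<^sub>j\<close> in absolute value at every order from two
  on. So only walks without edges used exactly once contribute, and each of them contributes at
  most the product of \<open>p\<close> over the steps that discover a new vertex (its \<open>discovery_weight\<close>).

  Group the walks by shape, that is, up to an injective relabelling of the vertices. If a shape
  has \<open>m\<close> vertices, then the discovery weights of the walks of this shape sum to at most
  \<open>n D\<^sup>m\<^sup>-\<^sup>1\<close> for every \<open>D \<ge> d\<close>, because each newly discovered vertex brings a factor of at most
  \<open>D\<close>. On the other hand, if \<open>r\<close> exceeds the length of the walk by at least \<open>D\<close>, then at least
  \<open>r D\<^sup>m\<^sup>-\<^sup>1\<close> walks on \<open>r\<close> vertices have this shape. Hence the expected trace is at most \<open>n / r\<close>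
  times the number of closed walks on \<open>r\<close> vertices that use no edge exactly once
  (\<open>sum_discovery_weight_le_card_good_walks\<close>).

  This number is estimated by running the trace formula backwards. For the random graph on \<open>r\<close>
  vertices with all edge probabilities \<open>1/3\<close>, the centred moments are nonnegative, and those of
  order \<open>k \<noteq> 1\<close> are at least \<open>3\<^sup>-\<^sup>k\<close> (\<open>bernoulli_moment_third_ge\<close>), so up to a factor exponential
  in the length the number of walks is at most the expected trace for that dense graph, hence at
  most \<open>r\<close> times the moment of its norm.
  The norm of the dense matrix is accessible by a grid argument: the norm is attained up
  to a constant on a set of exponentially many pairs of grid vectors, and for each pair the
  bilinear form is subgaussian (\<open>expectation_dense_spectral_norm_power\<close>).

  Choose \<open>q\<close> to be a power of two comparable to \<open>max(1, d, log n)\<close>, \<open>D = q\<close>, walks of length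
  \<open>2q\<close>, and \<open>r = 4q\<close>. Since \<open>r\<close> is of the order of the length, the exponential size of the grid is
  only a factor \<open>K\<^sup>q\<close>, and since \<open>n \<le> e\<^sup>q\<close>, so is the factor \<open>n\<close>. The result is
  \<open>E \<parallel>M\<parallel>\<^sup>2\<^sup>q \<le> (K q)\<^sup>q\<close>, that is, \<open>E \<parallel>M\<parallel> \<le> 2 (K q)\<^sup>1\<^sup>/\<^sup>2\<close>, which is the claim when \<open>n \<ge> 2\<close>. For \<open>n = 1\<close>
  the term \<open>max(1, \<dots>)\<close> would be too large, but the matrix is a single centred Bernoulli variable.
\<close>

section \<open>Matrices acting on functions, and traces of their powers\<close>

definition mat_vec :: "nat \<Rightarrow> (nat \<Rightarrow> nat \<Rightarrow> real) \<Rightarrow> (nat \<Rightarrow> real) \<Rightarrow> nat \<Rightarrow> real" where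
  "mat_vec n M x i = (\<Sum>j=1..n. M i j * x j)"

lemma spectral_norm_eq_SUP_mat_vec:
  "spectral_norm n M = (SUP x \<in> {x. L2_set x {1..n} \<le> 1}. L2_set (mat_vec n M x) {1..n})"
  unfolding spectral_norm_def mat_vec_def ..

lemma mat_vec_cong:
  "(\<And>j. j \<in> {1..n} \<Longrightarrow> x j = y j) \<Longrightarrow> mat_vec n M x = mat_vec n M y"
  by (auto simp: mat_vec_def fun_eq_iff intro!: sum.cong)

lemma spectral_norm_cong:
  assumes "\<And>i j. i \<in> {1..n} \<Longrightarrow> j \<in> {1..n} \<Longrightarrow> M i j = M' i j"
  shows "spectral_norm n M = spectral_norm n M'"
proof -
  have "L2_set (mat_vec n M x) {1..n} = L2_set (mat_vec n M' x) {1..n}" for x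
    by (rule L2_set_cong) (auto simp: mat_vec_def assms intro!: sum.cong)
  then show ?thesis
    by (simp add: spectral_norm_eq_SUP_mat_vec)
qed

lemma L2_set_mat_vec_le_sum_abs:
  assumes "L2_set x {1..n} \<le> 1"
  shows "L2_set (mat_vec n M x) {1..n} \<le> (\<Sum>i=1..n. \<Sum>j=1..n. \<bar>M i j\<bar>)"
proof -
  have x: "\<bar>x j\<bar> \<le> 1" if "j \<in> {1..n}" for j
  proof -
    have "\<bar>x j\<bar> \<le> L2_set (\<lambda>j. \<bar>x j\<bar>) {1..n}"
      by (rule member_le_L2_set) (use that in auto)
    also have "\<dots> = L2_set x {1..n}" by (simp add: L2_set_def)
    finally show ?thesis using assms by linarith
  qed
  have "L2_set (mat_vec n M x) {1..n} \<le> (\<Sum>i=1..n. \<bar>mat_vec n M x i\<bar>)"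
    by (rule L2_set_le_sum_abs)
  also have "\<dots> \<le> (\<Sum>i=1..n. \<Sum>j=1..n. \<bar>M i j * x j\<bar>)"
    unfolding mat_vec_def by (intro sum_mono sum_abs)
  also have "\<dots> \<le> (\<Sum>i=1..n. \<Sum>j=1..n. \<bar>M i j\<bar>)"
    using x by (intro sum_mono) (auto simp: abs_mult intro!: mult_left_le)
  finally show ?thesis .
qed

lemma bdd_above_mat_vec:
  "bdd_above ((\<lambda>x. L2_set (mat_vec n M x) {1..n}) ` {x. L2_set x {1..n} \<le> 1})"
  using L2_set_mat_vec_le_sum_abs by (auto intro!: bdd_aboveI)

lemma spectral_norm_leI:
  assumes "\<And>x. L2_set x {1..n} \<le> 1 \<Longrightarrow> L2_set (mat_vec n M x) {1..n} \<le> B"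
  shows "spectral_norm n M \<le> B"
  unfolding spectral_norm_eq_SUP_mat_vec
  by (rule cSUP_least) (use assms in \<open>auto intro: exI[of _ "\<lambda>_. 0"] simp: L2_set_def\<close>)

lemma mat_vec_le_spectral_norm:
  assumes "L2_set x {1..n} \<le> 1"
  shows "L2_set (mat_vec n M x) {1..n} \<le> spectral_norm n M"
  unfolding spectral_norm_eq_SUP_mat_vec
  by (rule cSUP_upper[OF _ bdd_above_mat_vec]) (use assms in auto)

lemma spectral_norm_nonneg: "0 \<le> spectral_norm n M"
  by (rule order_trans[OF L2_set_nonneg mat_vec_le_spectral_norm[of "\<lambda>_. 0"]]) (simp add: L2_set_def)

lemma mat_vec_scale: "mat_vec n M (\<lambda>j. c * x j) = (\<lambda>i. c * mat_vec n M x i)"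
  by (auto simp: mat_vec_def fun_eq_iff sum_distrib_left mult_ac)

lemma mat_vec_add: "mat_vec n M (\<lambda>j. x j + y j) = (\<lambda>i. mat_vec n M x i + mat_vec n M y i)"
  by (auto simp: mat_vec_def fun_eq_iff sum.distrib algebra_simps)

lemma L2_set_scale: "L2_set (\<lambda>i. c * x i) A = \<bar>c\<bar> * L2_set x A"
  by (simp add: L2_set_def power_mult_distrib real_sqrt_mult flip: sum_distrib_left)

lemma L2_set_mat_vec_le:
  "L2_set (mat_vec n M x) {1..n} \<le> spectral_norm n M * L2_set x {1..n}"
proof (cases "L2_set x {1..n} = 0")
  case True
  then have "mat_vec n M x = mat_vec n M (\<lambda>_. 0)"
    by (intro mat_vec_cong) (auto simp: L2_set_eq_0_iff)
  then show ?thesis using True by (simp add: mat_vec_def L2_set_def)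
next
  case False
  define c where "c = L2_set x {1..n}"
  have c: "c > 0" using False by (simp add: c_def order_less_le)
  have "L2_set (mat_vec n M (\<lambda>j. (1 / c) * x j)) {1..n} \<le> spectral_norm n M"
    by (rule mat_vec_le_spectral_norm, subst L2_set_scale) (use c in \<open>simp add: c_def\<close>)
  then show ?thesis
    unfolding mat_vec_scale L2_set_scale using c by (simp add: c_def field_simps)
qed

abbreviation mat_pow :: "nat \<Rightarrow> (nat \<Rightarrow> nat \<Rightarrow> real) \<Rightarrow> nat \<Rightarrow> (nat \<Rightarrow> real) \<Rightarrow> nat \<Rightarrow> real" where
  "mat_pow n M k x \<equiv> (mat_vec n M ^^ k) x"

definition unit_vec :: "nat \<Rightarrow> nat \<Rightarrow> real" where
  "unit_vec i j = of_bool (i = j)"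

text \<open>
  The matrices are functions restricted to \<open>{1..n}\<close>, so the power acts by iterating
  \<open>mat_vec\<close>, and the diagonal entries are read off from the images of the unit vectors.
\<close>

definition trace_pow :: "nat \<Rightarrow> (nat \<Rightarrow> nat \<Rightarrow> real) \<Rightarrow> nat \<Rightarrow> real" where
  "trace_pow n M k = (\<Sum>i=1..n. mat_pow n M k (unit_vec i) i)"

lemma L2_set_unit_vec: "i \<in> {1..n} \<Longrightarrow> L2_set (unit_vec i) {1..n} = 1"
  by (simp add: L2_set_def unit_vec_def power2_eq_square flip: of_bool_conj)

lemma L2_set_mat_pow_le:
  "L2_set (mat_pow n M k x) {1..n} \<le> spectral_norm n M ^ k * L2_set x {1..n}"
proof (induction k)
  case (Suc k)
  have "L2_set (mat_pow n M (Suc k) x) {1..n} \<le> spectral_norm n M * L2_set (mat_pow n M k x) {1..n}"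
    using L2_set_mat_vec_le by simp
  also have "\<dots> \<le> spectral_norm n M * (spectral_norm n M ^ k * L2_set x {1..n})"
    by (rule mult_left_mono[OF Suc spectral_norm_nonneg])
  finally show ?case by (simp add: mult_ac)
qed simp

text \<open>
  Linearity of the iterated action: the columns of the power are the images of the unit vectors.
\<close>

lemma mat_pow_expand:
  assumes "i \<in> {1..n}"
  shows "mat_pow n M k x i = (\<Sum>j=1..n. mat_pow n M k (unit_vec j) i * x j)"
  using assms
proof (induction k arbitrary: i)
  case 0
  then show ?case by (simp add: unit_vec_def)
next
  case (Suc k)
  have "mat_pow n M (Suc k) x i = (\<Sum>l=1..n. M i l * (\<Sum>j=1..n. mat_pow n M k (unit_vec j) l * x j))"
    by (simp add: mat_vec_def[of n M "mat_pow n M k x"] Suc.IH)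
  also have "\<dots> = (\<Sum>l=1..n. \<Sum>j=1..n. M i l * mat_pow n M k (unit_vec j) l * x j)"
    by (simp add: sum_distrib_left mult_ac)
  also have "\<dots> = (\<Sum>j=1..n. mat_pow n M (Suc k) (unit_vec j) i * x j)"
    by (subst sum.swap) (simp add: mat_vec_def sum_distrib_left mult_ac)
  finally show ?case .
qed

lemma mat_vec_symmetric:
  assumes sym: "\<And>i j. i \<in> {1..n} \<Longrightarrow> j \<in> {1..n} \<Longrightarrow> M i j = M j i"
  shows "(\<Sum>i=1..n. mat_vec n M x i * y i) = (\<Sum>i=1..n. x i * mat_vec n M y i)"
proof -
  have "(\<Sum>i=1..n. mat_vec n M x i * y i) = (\<Sum>i=1..n. \<Sum>j=1..n. M i j * x j * y i)"
    by (simp add: mat_vec_def sum_distrib_right)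
  also have "\<dots> = (\<Sum>j=1..n. \<Sum>i=1..n. M j i * x j * y i)"
    by (subst sum.swap) (auto intro!: sum.cong simp: sym)
  also have "\<dots> = (\<Sum>i=1..n. x i * mat_vec n M y i)"
    by (simp add: mat_vec_def sum_distrib_left mult_ac)
  finally show ?thesis .
qed

lemma mat_pow_symmetric:
  assumes sym: "\<And>i j. i \<in> {1..n} \<Longrightarrow> j \<in> {1..n} \<Longrightarrow> M i j = M j i"
  shows "(\<Sum>i=1..n. mat_pow n M k x i * y i) = (\<Sum>i=1..n. x i * mat_pow n M k y i)"
proof (induction k arbitrary: y)
  case (Suc k)
  have "(\<Sum>i=1..n. mat_pow n M (Suc k) x i * y i) = (\<Sum>i=1..n. mat_pow n M k x i * mat_vec n M y i)"
    using mat_vec_symmetric[OF sym] by simp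
  also have "\<dots> = (\<Sum>i=1..n. x i * mat_pow n M (Suc k) y i)"
    using Suc[of "mat_vec n M y"] by (simp add: funpow_swap1)
  finally show ?case .
qed simp

text \<open>
  The trace of an even power of a symmetric matrix is the squared Hilbert-Schmidt norm of the
  half power, because \<open>\<langle>e\<^sub>i, M\<^sup>2\<^sup>N e\<^sub>i\<rangle> = \<parallel>M\<^sup>N e\<^sub>i\<parallel>\<^sup>2\<close>.
\<close>

lemma trace_pow_double:
  assumes sym: "\<And>i j. i \<in> {1..n} \<Longrightarrow> j \<in> {1..n} \<Longrightarrow> M i j = M j i"
  shows "trace_pow n M (2 * N) = (\<Sum>i=1..n. (L2_set (mat_pow n M N (unit_vec i)) {1..n})\<^sup>2)"
proof -
  have "mat_pow n M (2 * N) (unit_vec i) i = (L2_set (mat_pow n M N (unit_vec i)) {1..n})\<^sup>2"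
    if "i \<in> {1..n}" for i
  proof -
    have "mat_pow n M (2 * N) (unit_vec i) i
        = (\<Sum>j=1..n. unit_vec i j * mat_pow n M N (mat_pow n M N (unit_vec i)) j)"
      using that by (simp add: unit_vec_def mult_2 funpow_add)
    also have "\<dots> = (\<Sum>j=1..n. mat_pow n M N (unit_vec i) j * mat_pow n M N (unit_vec i) j)"
      by (rule mat_pow_symmetric[OF sym, symmetric])
    finally show ?thesis
      by (simp add: L2_set_def power2_eq_square sum_nonneg)
  qed
  then show ?thesis unfolding trace_pow_def by simp
qed

lemma trace_pow_le_spectral_norm:
  assumes sym: "\<And>i j. i \<in> {1..n} \<Longrightarrow> j \<in> {1..n} \<Longrightarrow> M i j = M j i"
  shows "trace_pow n M (2 * N) \<le> n * spectral_norm n M ^ (2 * N)"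
proof -
  have "(L2_set (mat_pow n M N (unit_vec i)) {1..n})\<^sup>2 \<le> (spectral_norm n M ^ N)\<^sup>2"
    if "i \<in> {1..n}" for i
    using L2_set_mat_pow_le[where n = n and M = M and k = N and x = "unit_vec i"]
    unfolding L2_set_unit_vec[OF that] by (intro power_mono) simp_all
  then have "(\<Sum>i=1..n. (L2_set (mat_pow n M N (unit_vec i)) {1..n})\<^sup>2)
      \<le> (\<Sum>i=1..n. (spectral_norm n M ^ N)\<^sup>2)"
    by (intro sum_mono)
  then show ?thesis
    using trace_pow_double[OF sym, where N = N]
    by (simp only: power_even_eq sum_constant card_atLeastAtMost) simp
qed

lemma sum_mult_le_L2_set: "\<bar>\<Sum>i\<in>A. f i * g i\<bar> \<le> L2_set f A * L2_set g A"
proof -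
  have "\<bar>\<Sum>i\<in>A. f i * g i\<bar> \<le> (\<Sum>i\<in>A. \<bar>f i\<bar> * \<bar>g i\<bar>)"
    using sum_abs[of "\<lambda>i. f i * g i" A] by (simp add: abs_mult)
  also have "\<dots> \<le> L2_set f A * L2_set g A"
    by (rule L2_set_mult_ineq)
  finally show ?thesis .
qed

lemma L2_set_mat_pow_le_trace:
  assumes sym: "\<And>i j. i \<in> {1..n} \<Longrightarrow> j \<in> {1..n} \<Longrightarrow> M i j = M j i"
    and x: "L2_set x {1..n} \<le> 1"
  shows "(L2_set (mat_pow n M N x) {1..n})\<^sup>2 \<le> trace_pow n M (2 * N)"
proof -
  let ?m = "\<lambda>i j. mat_pow n M N (unit_vec j) i"
  have row: "(mat_pow n M N x i)\<^sup>2 \<le> (\<Sum>j=1..n. (?m i j)\<^sup>2)" if "i \<in> {1..n}" for i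
  proof -
    have "\<bar>mat_pow n M N x i\<bar> \<le> L2_set (?m i) {1..n} * L2_set x {1..n}"
      by (subst mat_pow_expand[OF that]) (rule sum_mult_le_L2_set)
    also have "\<dots> \<le> L2_set (?m i) {1..n} * 1"
      by (rule mult_left_mono[OF x]) simp
    finally have "\<bar>mat_pow n M N x i\<bar>\<^sup>2 \<le> (L2_set (?m i) {1..n})\<^sup>2"
      by (intro power_mono) auto
    then show ?thesis by (simp add: L2_set_def sum_nonneg)
  qed
  have "(L2_set (mat_pow n M N x) {1..n})\<^sup>2 = (\<Sum>i=1..n. (mat_pow n M N x i)\<^sup>2)"
    by (simp add: L2_set_def sum_nonneg)
  also have "\<dots> \<le> (\<Sum>i=1..n. \<Sum>j=1..n. (?m i j)\<^sup>2)"
    by (rule sum_mono) (rule row)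
  also have "\<dots> = (\<Sum>j=1..n. \<Sum>i=1..n. (?m i j)\<^sup>2)"
    by (rule sum.swap)
  also have "\<dots> = trace_pow n M (2 * N)"
    by (subst trace_pow_double[OF sym]) (simp_all add: L2_set_def sum_nonneg)
  finally show ?thesis .
qed

text \<open>
  Repeated squaring takes the place of the spectral theorem: for a unit vector \<open>x\<close> and symmetric
  \<open>B\<close>, \<open>\<parallel>B x\<parallel>\<^sup>2 = \<langle>x, B\<^sup>2 x\<rangle> \<le> \<parallel>B\<^sup>2 x\<parallel>\<close>, applied to \<open>B = M, M\<^sup>2, M\<^sup>4, \<dots>\<close>.
\<close>

lemma L2_set_mat_vec_pow_two_le:
  assumes sym: "\<And>i j. i \<in> {1..n} \<Longrightarrow> j \<in> {1..n} \<Longrightarrow> M i j = M j i"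
    and x: "L2_set x {1..n} \<le> 1"
  shows "L2_set (mat_vec n M x) {1..n} ^ (2 ^ k) \<le> L2_set (mat_pow n M (2 ^ k) x) {1..n}"
proof (induction k)
  case (Suc k)
  let ?y = "mat_pow n M (2 ^ k) x"
  have "L2_set (mat_vec n M x) {1..n} ^ (2 ^ Suc k) = (L2_set (mat_vec n M x) {1..n} ^ (2 ^ k))\<^sup>2"
    by (simp only: power_Suc power_even_eq)
  also have "\<dots> \<le> (L2_set ?y {1..n})\<^sup>2"
    using Suc by (intro power_mono) auto
  also have "\<dots> = (\<Sum>i=1..n. ?y i * ?y i)"
    by (simp add: L2_set_def sum_nonneg power2_eq_square)
  also have "\<dots> = (\<Sum>i=1..n. x i * mat_pow n M (2 ^ k) ?y i)"
    by (rule mat_pow_symmetric[OF sym])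
  also have "\<dots> \<le> L2_set x {1..n} * L2_set (mat_pow n M (2 ^ k) ?y) {1..n}"
    using sum_mult_le_L2_set abs_le_D1 by blast
  also have "\<dots> \<le> 1 * L2_set (mat_pow n M (2 ^ k) ?y) {1..n}"
    by (rule mult_right_mono[OF x]) simp
  finally show ?case
    by (simp add: mult_2 funpow_add)
qed simp

lemma spectral_norm_le_trace_pow:
  assumes sym: "\<And>i j. i \<in> {1..n} \<Longrightarrow> j \<in> {1..n} \<Longrightarrow> M i j = M j i"
  shows "spectral_norm n M ^ (2 * 2 ^ k) \<le> trace_pow n M (2 * 2 ^ k)"
proof -
  let ?T = "trace_pow n M (2 * 2 ^ k)" and ?L = "2 * 2 ^ k :: nat"
  have T: "0 \<le> ?T"
    by (subst trace_pow_double[OF sym]) (auto intro: sum_nonneg)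
  have "spectral_norm n M \<le> root ?L ?T"
  proof (rule spectral_norm_leI)
    fix x :: "nat \<Rightarrow> real" assume x: "L2_set x {1..n} \<le> 1"
    have "L2_set (mat_vec n M x) {1..n} ^ ?L = (L2_set (mat_vec n M x) {1..n} ^ (2 ^ k))\<^sup>2"
      by (rule power_even_eq)
    also have "\<dots> \<le> (L2_set (mat_pow n M (2 ^ k) x) {1..n})\<^sup>2"
      by (intro power_mono L2_set_mat_vec_pow_two_le[OF sym x]) auto
    also have "\<dots> \<le> ?T"
      by (rule L2_set_mat_pow_le_trace[OF sym x])
    finally have "root ?L (L2_set (mat_vec n M x) {1..n} ^ ?L) \<le> root ?L ?T"
      by (intro real_root_le_mono) auto
    then show "L2_set (mat_vec n M x) {1..n} \<le> root ?L ?T"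
      by (subst (asm) real_root_power_cancel) auto
  qed
  then have "spectral_norm n M ^ ?L \<le> root ?L ?T ^ ?L"
    by (intro power_mono spectral_norm_nonneg)
  also have "\<dots> = ?T" using T by (intro real_root_pow_pos2) auto
  finally show ?thesis .
qed

section \<open>Closed walks and the trace\<close>

fun walk_weight :: "('a \<Rightarrow> 'a \<Rightarrow> real) \<Rightarrow> 'a list \<Rightarrow> real" where
  "walk_weight M (x # y # zs) = M x y * walk_weight M (y # zs)"
| "walk_weight M _ = 1"

text \<open>
  The length \<open>k\<close> counts vertices here, while in \<open>closed_walks n k\<close> it counts steps.
\<close>

definition walks :: "nat \<Rightarrow> nat \<Rightarrow> nat list set" where
  "walks n k = {xs. set xs \<subseteq> {1..n} \<and> length xs = k}"

definition closed_walks :: "nat \<Rightarrow> nat \<Rightarrow> nat list set" where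
  "closed_walks n k = {xs \<in> walks n (Suc k). hd xs = last xs}"

lemma finite_walks [simp]: "finite (walks n k)"
  unfolding walks_def by (rule finite_lists_length_eq) simp

lemma finite_closed_walks [simp]: "finite (closed_walks n k)"
  by (simp add: closed_walks_def)

lemma sum_walks_Suc: "(\<Sum>xs\<in>walks n (Suc k). f xs) = (\<Sum>i=1..n. \<Sum>xs\<in>walks n k. f (i # xs))"
proof -
  have "(\<Sum>xs\<in>walks n (Suc k). f xs) = (\<Sum>(xs, i)\<in>walks n k \<times> {1..n}. f (i # xs))"
    unfolding walks_def lists_length_Suc_eq
    by (subst sum.reindex) (auto simp: inj_on_def case_prod_unfold)
  also have "\<dots> = (\<Sum>xs\<in>walks n k. \<Sum>i=1..n. f (i # xs))"
    by (rule sum.cartesian_product[symmetric])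
  also have "\<dots> = (\<Sum>i=1..n. \<Sum>xs\<in>walks n k. f (i # xs))"
    by (rule sum.swap)
  finally show ?thesis .
qed

lemma mat_pow_eq_sum_walks:
  "mat_pow n M k x i = (\<Sum>xs\<in>walks n k. walk_weight M (i # xs) * x (last (i # xs)))"
proof (induction k arbitrary: i)
  case 0
  have "walks n 0 = {[]}" by (auto simp: walks_def)
  then show ?case by simp
next
  case (Suc k)
  then show ?case
    by (simp add: sum_walks_Suc mat_vec_def[of n M "mat_pow n M k x"] sum_distrib_left mult.assoc)
qed

lemma trace_pow_eq_sum_closed_walks:
  "trace_pow n M k = (\<Sum>xs\<in>closed_walks n k. walk_weight M xs)"
proof -
  have "trace_pow n M k = (\<Sum>xs\<in>walks n (Suc k). walk_weight M xs * of_bool (hd xs = last xs))"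
    unfolding trace_pow_def mat_pow_eq_sum_walks sum_walks_Suc by (simp add: unit_vec_def)
  also have "\<dots> = (\<Sum>xs\<in>closed_walks n k. walk_weight M xs)"
    unfolding closed_walks_def by (rule sum.mono_neutral_cong_right) auto
  finally show ?thesis .
qed

text \<open>
  The pair under which the random graph stores an undirected edge.
\<close>

definition edge :: "nat \<Rightarrow> nat \<Rightarrow> nat \<times> nat" where
  "edge a b = (min a b, max a b)"

lemma edge_commute: "edge a b = edge b a"
  by (simp add: edge_def min.commute max.commute)

lemma edge_eq_iff: "edge a b = edge c d \<longleftrightarrow> (a = c \<and> b = d) \<or> (a = d \<and> b = c)"
  by (auto simp: edge_def min_def max_def split: if_splits)

fun edges :: "nat list \<Rightarrow> (nat \<times> nat) list" where
  "edges (x # y # zs) = edge x y # edges (y # zs)"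
| "edges _ = []"

lemma length_edges: "length (edges xs) = length xs - 1"
  by (induction xs rule: edges.induct) auto

definition pairs :: "nat \<Rightarrow> (nat \<times> nat) set" where
  "pairs n = {(i, j). 1 \<le> i \<and> i \<le> j \<and> j \<le> n}"

lemma finite_pairs [simp]: "finite (pairs n)"
  by (rule finite_subset[of _ "{1..n} \<times> {1..n}"]) (auto simp: pairs_def)

lemma edge_in_pairs: "i \<in> {1..n} \<Longrightarrow> j \<in> {1..n} \<Longrightarrow> edge i j \<in> pairs n"
  by (auto simp: pairs_def edge_def)

lemma set_edges_subset: "set xs \<subseteq> {1..n} \<Longrightarrow> set (edges xs) \<subseteq> pairs n"
  by (induction xs rule: edges.induct) (auto simp: edge_in_pairs)

lemma edge_in_set_edgesD: "edge a b \<in> set (edges xs) \<Longrightarrow> a \<in> set xs \<and> b \<in> set xs"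
  by (induction xs rule: edges.induct) (auto simp: edge_eq_iff)

lemma set_edges_edge: "e \<in> set (edges xs) \<Longrightarrow> \<exists>a\<in>set xs. \<exists>b\<in>set xs. e = edge a b"
  by (induction xs rule: edges.induct) auto

lemma prod_list_eq_prod_count:
  fixes f :: "'a \<Rightarrow> real"
  assumes "set xs \<subseteq> E" "finite E"
  shows "prod_list (map f xs) = (\<Prod>e\<in>E. f e ^ count_list xs e)"
  using assms
proof (induction xs)
  case (Cons x xs)
  have "(\<Prod>e\<in>E. f e ^ count_list (x # xs) e)
      = (\<Prod>e\<in>E. (if e = x then f x else 1) * f e ^ count_list xs e)"
    by (rule prod.cong) auto
  also have "\<dots> = f x * (\<Prod>e\<in>E. f e ^ count_list xs e)"
    using Cons.prems by (simp add: prod.distrib)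
  finally show ?case using Cons by simp
qed simp

text \<open>
  The entries of a symmetric random matrix depend on the undirected edge only, so the weight of a
  walk is a product of independent factors once equal edges are collected.
\<close>

lemma walk_weight_edge: "walk_weight (\<lambda>i j. f (edge i j)) xs = prod_list (map f (edges xs))"
  by (induction xs rule: edges.induct) auto

section \<open>Walks of the same shape\<close>

text \<open>
  Walks are identified up to relabelling their vertices, because which steps of a walk share an
  edge depends only on this class.
\<close>

definition same_shape :: "nat list \<Rightarrow> nat list \<Rightarrow> bool" where
  "same_shape xs ys \<longleftrightarrow> (\<exists>f. inj_on f (set xs) \<and> ys = map f xs)"

lemma same_shape_sym: "same_shape xs ys \<Longrightarrow> same_shape ys xs"
proof -
  assume "same_shape xs ys"
  then obtain f where f: "inj_on f (set xs)" "ys = map f xs"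
    by (auto simp: same_shape_def)
  have "inj_on (inv_into (set xs) f) (set ys)" "xs = map (inv_into (set xs) f) ys"
    using f by (auto simp: inj_on_inv_into map_idI)
  then show ?thesis unfolding same_shape_def by blast
qed

lemma same_shape_commute: "same_shape xs ys \<longleftrightarrow> same_shape ys xs"
  using same_shape_sym by blast

lemma same_shape_length: "same_shape xs ys \<Longrightarrow> length ys = length xs"
  by (auto simp: same_shape_def)

lemma same_shape_card: "same_shape xs ys \<Longrightarrow> card (set ys) = card (set xs)"
  by (auto simp: same_shape_def card_image)

lemma same_shape_closed:
  assumes "same_shape xs ys" "hd xs = last xs"
  shows "hd ys = last ys"
  using assms by (cases "xs = []") (auto simp: same_shape_def hd_map last_map)

definition no_single_edge :: "nat list \<Rightarrow> bool" where
  "no_single_edge xs \<longleftrightarrow> (\<forall>e. count_list (edges xs) e \<noteq> 1)"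

lemma same_shape_no_single_edge:
  assumes "same_shape xs ys" and xs: "no_single_edge xs"
  shows "no_single_edge ys"
proof -
  obtain f where f: "inj_on f (set xs)" "ys = map f xs"
    using assms by (auto simp: same_shape_def)
  \<comment> \<open>The relabelling \<open>f\<close> need not be monotone, so the relabelled edge is sorted again.\<close>
  define F where "F = (\<lambda>(a, b). edge (f a) (f b))"
  have F: "F (edge a b) = edge (f a) (f b)" for a b
    by (auto simp: F_def edge_def min_def max_def)
  have edges_map: "edges (map f zs) = map F (edges zs)" for zs
    by (induction zs rule: edges.induct) (simp_all add: F)
  have inj: "inj_on F (set (edges xs))"
  proof (rule inj_onI)
    fix e e' assume e: "e \<in> set (edges xs)" "e' \<in> set (edges xs)" "F e = F e'"
    obtain a b c d where "a \<in> set xs" "b \<in> set xs" "c \<in> set xs" "d \<in> set xs"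
      "e = edge a b" "e' = edge c d"
      using e set_edges_edge by metis
    then show "e = e'"
      using e f(1) by (auto simp: F edge_eq_iff inj_on_eq_iff)
  qed
  show ?thesis unfolding no_single_edge_def
  proof
    fix e
    show "count_list (edges ys) e \<noteq> 1"
    proof (cases "e \<in> set (edges ys)")
      case True
      then obtain e' where e': "e' \<in> set (edges xs)" "e = F e'"
        by (auto simp: f edges_map)
      then have "count_list (edges ys) e = count_list (edges xs) e'"
        using count_list_inj_map[OF inj] by (simp add: f edges_map)
      with xs show ?thesis unfolding no_single_edge_def by metis
    qed simp
  qed
qed

text \<open>
  This lemma and the next describe how a walk is extended at its front within a shape: a vertex
  that is new in \<open>x # xs\<close> may be matched by any vertex that is new, and a vertex seen before
  has exactly one match.
\<close>

lemma same_shape_Cons_new: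
  assumes "x \<notin> set xs"
  shows "same_shape (x # xs) (y # ys) \<longleftrightarrow> same_shape xs ys \<and> y \<notin> set ys"
proof
  assume "same_shape (x # xs) (y # ys)"
  then show "same_shape xs ys \<and> y \<notin> set ys"
    using assms by (auto simp: same_shape_def)
next
  assume *: "same_shape xs ys \<and> y \<notin> set ys"
  then obtain f where f: "inj_on f (set xs)" "ys = map f xs" "y \<notin> set ys"
    by (auto simp: same_shape_def)
  let ?f = "f(x := y)"
  have "map ?f xs = ys" using f assms by auto
  moreover have "inj_on ?f (set (x # xs))"
    using f assms by (auto simp: inj_on_def)
  ultimately show "same_shape (x # xs) (y # ys)"
    unfolding same_shape_def by (intro exI[of _ ?f]) auto
qed

lemma same_shape_Cons_old:
  assumes "x \<in> set xs" and "same_shape xs ys"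
  obtains y where "y \<in> set ys" "\<And>z. same_shape (x # xs) (z # ys) \<longleftrightarrow> z = y"
proof -
  obtain f where f: "inj_on f (set xs)" "ys = map f xs"
    using assms by (auto simp: same_shape_def)
  have "same_shape (x # xs) (z # ys) \<longleftrightarrow> z = f x" for z
  proof
    assume "same_shape (x # xs) (z # ys)"
    then obtain g where "z = g x" "map f xs = map g xs"
      by (auto simp: same_shape_def f)
    then show "z = f x" using assms(1) by auto
  next
    assume "z = f x"
    then show "same_shape (x # xs) (z # ys)"
      using f assms(1) by (auto simp: same_shape_def insert_absorb intro!: exI[of _ f])
  qed
  then show ?thesis using f assms(1) that[of "f x"] by auto
qed

lemma same_shape_ConsD: "same_shape (x # xs) (y # ys) \<Longrightarrow> same_shape xs ys"
  by (auto simp: same_shape_def)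

definition shape_class :: "nat \<Rightarrow> nat list \<Rightarrow> nat list set" where
  "shape_class n xs = {ys. set ys \<subseteq> {1..n} \<and> same_shape xs ys}"

lemma shape_class_subset_walks: "shape_class n xs \<subseteq> walks n (length xs)"
  by (auto simp: shape_class_def walks_def same_shape_length)

lemma finite_shape_class [simp]: "finite (shape_class n xs)"
  by (rule finite_subset[OF shape_class_subset_walks]) simp

text \<open>
  Walks of a given shape are enumerated from the back to the front.
\<close>

lemma sum_shape_class_Cons_new:
  assumes "x \<notin> set xs"
  shows "(\<Sum>ys\<in>shape_class n (x # xs). f ys) = (\<Sum>ys\<in>shape_class n xs. \<Sum>y\<in>{1..n} - set ys. f (y # ys))"
proof -
  have "(\<Sum>ys\<in>shape_class n xs. \<Sum>y\<in>{1..n} - set ys. f (y # ys))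
      = (\<Sum>(ys, y)\<in>Sigma (shape_class n xs) (\<lambda>ys. {1..n} - set ys). f (y # ys))"
    by (rule sum.Sigma) auto
  also have "\<dots> = (\<Sum>ys\<in>shape_class n (x # xs). f ys)"
  proof -
    have "bij_betw (\<lambda>p. snd p # fst p) (Sigma (shape_class n xs) (\<lambda>ys. {1..n} - set ys)) (shape_class n (x # xs))"
    proof (rule bij_betw_imageI)
      show "inj_on (\<lambda>p. snd p # fst p) (Sigma (shape_class n xs) (\<lambda>ys. {1..n} - set ys))"
        by (auto simp: inj_on_def)
      show "(\<lambda>p. snd p # fst p) ` Sigma (shape_class n xs) (\<lambda>ys. {1..n} - set ys) = shape_class n (x # xs)"
      proof (intro equalityI subsetI)
        fix zs assume "zs \<in> (\<lambda>p. snd p # fst p) ` Sigma (shape_class n xs) (\<lambda>ys. {1..n} - set ys)"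
        then show "zs \<in> shape_class n (x # xs)"
          by (auto simp: shape_class_def same_shape_Cons_new[OF assms])
      next
        fix zs assume zs: "zs \<in> shape_class n (x # xs)"
        then obtain y ys where "zs = y # ys"
          by (auto simp: shape_class_def same_shape_def)
        with zs show "zs \<in> (\<lambda>p. snd p # fst p) ` Sigma (shape_class n xs) (\<lambda>ys. {1..n} - set ys)"
          by (auto simp: shape_class_def same_shape_Cons_new[OF assms] intro!: image_eqI[of _ _ "(ys, y)"])
      qed
    qed
    from sum.reindex_bij_betw[OF this, of f] show ?thesis
      by (simp add: case_prod_unfold)
  qed
  finally show ?thesis by simp
qed

lemma bij_betw_tl_shape_class:
  assumes "x \<in> set xs"
  shows "bij_betw tl (shape_class n (x # xs)) (shape_class n xs)"
proof (rule bij_betw_imageI)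
  show "inj_on tl (shape_class n (x # xs))"
  proof (rule inj_onI)
    fix ys zs assume *: "ys \<in> shape_class n (x # xs)" "zs \<in> shape_class n (x # xs)" "tl ys = tl zs"
    obtain y ys' z where yz: "ys = y # ys'" "zs = z # ys'"
      using * by (auto simp: shape_class_def same_shape_def)
    then have s: "same_shape (x # xs) (y # ys')" "same_shape (x # xs) (z # ys')"
      using * by (auto simp: shape_class_def)
    show "ys = zs"
      using same_shape_Cons_old[OF assms same_shape_ConsD[OF s(1)]] s yz by metis
  qed
  show "tl ` shape_class n (x # xs) = shape_class n xs"
  proof (intro equalityI subsetI)
    fix ys assume "ys \<in> tl ` shape_class n (x # xs)"
    then show "ys \<in> shape_class n xs"
      by (auto simp: shape_class_def same_shape_def)
  next
    fix ys assume ys: "ys \<in> shape_class n xs"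
    then obtain y where "y \<in> set ys" "same_shape (x # xs) (y # ys)"
      using same_shape_Cons_old[OF assms] by (metis (mono_tags, lifting) mem_Collect_eq shape_class_def)
    then have "y # ys \<in> shape_class n (x # xs)"
      using ys by (auto simp: shape_class_def)
    then show "ys \<in> tl ` shape_class n (x # xs)" by force
  qed
qed
text \<open>
  Read from its end, a walk is a sequence of steps towards the head of the list, and the weight
  collects the probabilities of the steps that reach a vertex for the first time. The edges of
  these steps form a spanning tree of the vertices of the walk.
\<close>

fun discovery_weight :: "(nat \<Rightarrow> nat \<Rightarrow> real) \<Rightarrow> nat list \<Rightarrow> real" where
  "discovery_weight p (x # y # zs) =
     (if x \<in> set (y # zs) then 1 else p x y) * discovery_weight p (y # zs)"
| "discovery_weight p _ = 1"

lemma discovery_weight_Cons: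
  "xs \<noteq> [] \<Longrightarrow> discovery_weight p (x # xs) =
     (if x \<in> set xs then 1 else p x (hd xs)) * discovery_weight p xs"
  by (cases xs) auto

lemma discovery_weight_nonneg:
  assumes "\<And>i j. i \<in> {1..n} \<Longrightarrow> j \<in> {1..n} \<Longrightarrow> 0 \<le> p i j" and "set xs \<subseteq> {1..n}"
  shows "0 \<le> discovery_weight p xs"
  using assms(2) by (induction xs rule: edges.induct) (use assms(1) in auto)

lemma shape_class_Nil: "shape_class n [] = {[]}"
  by (auto simp: shape_class_def same_shape_def)

lemma shape_class_nonempty_list:
  "ys \<in> shape_class n xs \<Longrightarrow> xs \<noteq> [] \<Longrightarrow> ys \<noteq> [] \<and> hd ys \<in> {1..n} \<and> set ys \<subseteq> {1..n}"
  by (cases ys) (auto simp: shape_class_def same_shape_def)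

lemma sum_shape_class_singleton: "(\<Sum>ys\<in>shape_class n [x]. f ys) = (\<Sum>y=1..n. f [y])"
  by (simp add: sum_shape_class_Cons_new shape_class_Nil)

lemma card_set_Cons_new:
  assumes "x \<notin> set xs" "xs \<noteq> []"
  shows "(D::real) ^ (card (set (x # xs)) - 1) = D * D ^ (card (set xs) - 1)"
proof -
  have "card (set xs) > 0" using assms by (simp add: card_gt_0_iff)
  then show ?thesis using assms by (cases "card (set xs)") auto
qed

text \<open>
  The last vertex of the walk is free, which gives the factor \<open>n\<close>. Each of the other
  \<open>m - 1\<close> vertices is discovered by one step, and summing over its position costs at most a column
  sum. The steps to vertices seen before are determined by the shape.
\<close>

lemma sum_discovery_weight_shape_class_le:
  assumes nonneg: "\<And>i j. i \<in> {1..n} \<Longrightarrow> j \<in> {1..n} \<Longrightarrow> 0 \<le> p i j"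
    and D: "\<And>j. j \<in> {1..n} \<Longrightarrow> (\<Sum>i=1..n. p i j) \<le> D"
    and "D \<ge> 0" and "xs \<noteq> []"
  shows "(\<Sum>ys\<in>shape_class n xs. discovery_weight p ys) \<le> real n * D ^ (card (set xs) - 1)"
  using \<open>xs \<noteq> []\<close>
proof (induction xs rule: list_nonempty_induct)
  case (single x)
  then show ?case by (simp add: sum_shape_class_singleton)
next
  case (cons x xs)
  show ?case
  proof (cases "x \<in> set xs")
    case True
    have "discovery_weight p ys = discovery_weight p (tl ys)" if "ys \<in> shape_class n (x # xs)" for ys
    proof -
      obtain f where f: "ys = f x # map f xs"
        using \<open>ys \<in> shape_class n (x # xs)\<close> by (auto simp: shape_class_def same_shape_def)
      then show ?thesis
        using True cons.hyps by (simp add: discovery_weight_Cons)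
    qed
    then have "(\<Sum>ys\<in>shape_class n (x # xs). discovery_weight p ys)
        = (\<Sum>ys\<in>shape_class n (x # xs). discovery_weight p (tl ys))"
      by (intro sum.cong) auto
    also have "\<dots> = (\<Sum>ys\<in>shape_class n xs. discovery_weight p ys)"
      by (rule sum.reindex_bij_betw[OF bij_betw_tl_shape_class[OF True]])
    finally show ?thesis using cons True by (simp add: insert_absorb)
  next
    case False
    have "(\<Sum>y\<in>{1..n} - set ys. discovery_weight p (y # ys)) \<le> D * discovery_weight p ys"
      if "ys \<in> shape_class n xs" for ys
    proof -
      have ys: "ys \<noteq> []" "hd ys \<in> {1..n}" "set ys \<subseteq> {1..n}"
        using shape_class_nonempty_list[OF that cons.hyps] by auto
      have "(\<Sum>y\<in>{1..n} - set ys. discovery_weight p (y # ys))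
          = (\<Sum>y\<in>{1..n} - set ys. p y (hd ys)) * discovery_weight p ys"
        by (simp add: discovery_weight_Cons[OF ys(1)] sum_distrib_right)
      also have "(\<Sum>y\<in>{1..n} - set ys. p y (hd ys)) \<le> (\<Sum>y=1..n. p y (hd ys))"
        using nonneg ys by (intro sum_mono2) auto
      also have "\<dots> \<le> D" using D ys by blast
      finally show ?thesis
        using discovery_weight_nonneg[OF nonneg ys(3)] by (simp add: mult_right_mono)
    qed
    then have "(\<Sum>ys\<in>shape_class n (x # xs). discovery_weight p ys)
        \<le> (\<Sum>ys\<in>shape_class n xs. D * discovery_weight p ys)"
      unfolding sum_shape_class_Cons_new[OF False] by (intro sum_mono)
    also have "\<dots> = D * (\<Sum>ys\<in>shape_class n xs. discovery_weight p ys)"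
      by (simp add: sum_distrib_left)
    also have "\<dots> \<le> D * (real n * D ^ (card (set xs) - 1))"
      by (rule mult_left_mono[OF cons.IH \<open>D \<ge> 0\<close>])
    also have "\<dots> = real n * D ^ (card (set (x # xs)) - 1)"
      unfolding card_set_Cons_new[OF False cons.hyps] by simp
    finally show ?thesis .
  qed
qed

text \<open>
  The same enumeration as for the upper bound: while a walk no longer than \<open>xs\<close> is built,
  at least \<open>r - length xs \<ge> D\<close> unused vertices are available for every discovery.
\<close>

lemma card_shape_class_ge:
  assumes "xs \<noteq> []" and "D \<ge> 0" and "D + real (length xs) \<le> real r"
  shows "real r * D ^ (card (set xs) - 1) \<le> real (card (shape_class r xs))"
  using assms(1,3)
proof (induction xs rule: list_nonempty_induct)
  case (single x)
  then show ?case
    using sum_shape_class_singleton[where f = "\<lambda>_. 1 :: real" and n = r and x = x] by simp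
next
  case (cons x xs)
  then have IH: "real r * D ^ (card (set xs) - 1) \<le> real (card (shape_class r xs))"
    by simp
  show ?case
  proof (cases "x \<in> set xs")
    case True
    then show ?thesis
      using IH bij_betw_same_card[OF bij_betw_tl_shape_class[OF True, of r]] by (simp add: insert_absorb)
  next
    case False
    have "D \<le> (\<Sum>y\<in>{1..r} - set ys. 1)" if "ys \<in> shape_class r xs" for ys
    proof -
      have ys: "set ys \<subseteq> {1..r}" "length ys = length xs"
        using that by (auto simp: shape_class_def same_shape_length)
      have "(\<Sum>y\<in>{1..r} - set ys. 1) = real (r - card (set ys))"
        using ys by (simp add: card_Diff_subset)
      moreover have "card (set ys) \<le> length xs"
        using ys card_length[of ys] by simp
      ultimately show ?thesis using cons.prems by simp
    qed
    then have "(\<Sum>ys\<in>shape_class r xs. D) \<le> (\<Sum>ys\<in>shape_class r xs. \<Sum>y\<in>{1..r} - set ys. 1)"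
      by (intro sum_mono)
    also have "\<dots> = (\<Sum>ys\<in>shape_class r (x # xs). 1)"
      by (rule sum_shape_class_Cons_new[OF False, symmetric])
    finally have "D * real (card (shape_class r xs)) \<le> real (card (shape_class r (x # xs)))"
      by (simp add: mult.commute)
    moreover have "D * (real r * D ^ (card (set xs) - 1)) \<le> D * real (card (shape_class r xs))"
      by (rule mult_left_mono[OF IH \<open>D \<ge> 0\<close>])
    ultimately show ?thesis
      unfolding card_set_Cons_new[OF False cons.hyps] by (simp add: mult.left_commute)
  qed
qed

text \<open>
  The closed walks that contribute to the expected trace of a centred matrix.
\<close>

definition good_walks :: "nat \<Rightarrow> nat \<Rightarrow> nat list set" where
  "good_walks n k = {xs \<in> closed_walks n k. no_single_edge xs}"

lemma finite_good_walks [simp]: "finite (good_walks n k)"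
  by (simp add: good_walks_def)

lemma good_walks_same_shape:
  assumes "xs \<in> good_walks n k" "same_shape xs ys" "set ys \<subseteq> {1..r}"
  shows "ys \<in> good_walks r k"
  using assms same_shape_no_single_edge[OF assms(2)] same_shape_closed[OF assms(2)]
    same_shape_length[OF assms(2)]
  by (auto simp: good_walks_def closed_walks_def walks_def)

lemma good_walksD:
  "xs \<in> good_walks n k \<Longrightarrow> xs \<noteq> [] \<and> length xs = Suc k \<and> set xs \<subseteq> {1..n}"
  by (auto simp: good_walks_def closed_walks_def walks_def)

text \<open>
  Double counting over the pairs \<open>(xs, zs)\<close> of walks of the same shape, \<open>xs\<close> in the given
  graph and \<open>zs\<close> on \<open>r\<close> vertices. With each pair weighted by \<open>1 / (r D\<^sup>m\<^sup>-\<^sup>1)\<close>, the lower bound on the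
  number of \<open>zs\<close> and the upper bound on the sum over \<open>xs\<close> match, and the number of
  vertices \<open>m\<close> cancels.
\<close>

lemma sum_discovery_weight_le_card_good_walks:
  assumes nonneg: "\<And>i j. i \<in> {1..n} \<Longrightarrow> j \<in> {1..n} \<Longrightarrow> 0 \<le> p i j"
    and D: "\<And>j. j \<in> {1..n} \<Longrightarrow> (\<Sum>i=1..n. p i j) \<le> D"
    and "D > 0" and r: "D + real (Suc k) \<le> real r"
  shows "(\<Sum>xs\<in>good_walks n k. discovery_weight p xs)
      \<le> real n / real r * real (card (good_walks r k))"
proof -
  have r0: "real r > 0" using r \<open>D > 0\<close> by linarith
  define c where "c = (\<lambda>xs::nat list. real r * D ^ (card (set xs) - 1))"
  have c: "c xs > 0" for xs unfolding c_def using r0 \<open>D > 0\<close> by simp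
  have c_eq: "c zs = c xs" if "same_shape xs zs" for xs zs
    using same_shape_card[OF that] by (simp add: c_def)
  have class_n: "{xs \<in> good_walks n k. same_shape xs zs} = shape_class n zs"
    if "zs \<in> good_walks r k" for zs
    using that good_walks_same_shape[of zs r k _ n] good_walksD[of _ n k]
    unfolding shape_class_def same_shape_commute[of _ zs] by blast
  have class_r: "{zs \<in> good_walks r k. same_shape xs zs} = shape_class r xs"
    if "xs \<in> good_walks n k" for xs
    using that good_walks_same_shape[of xs n k _ r] good_walksD[of _ r k]
    unfolding shape_class_def by blast
  have "(\<Sum>xs\<in>good_walks n k. discovery_weight p xs)
      \<le> (\<Sum>xs\<in>good_walks n k. \<Sum>zs | zs \<in> good_walks r k \<and> same_shape xs zs. discovery_weight p xs / c zs)"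
  proof (rule sum_mono)
    fix xs assume xs: "xs \<in> good_walks n k"
    have "discovery_weight p xs * c xs \<le> discovery_weight p xs * real (card (shape_class r xs))"
      unfolding c_def using good_walksD[OF xs] r \<open>D > 0\<close>
      by (intro mult_left_mono card_shape_class_ge discovery_weight_nonneg[OF nonneg]) auto
    then have "discovery_weight p xs \<le> (\<Sum>zs\<in>shape_class r xs. discovery_weight p xs / c xs)"
      using c[of xs] by (simp add: field_simps)
    also have "\<dots> = (\<Sum>zs | zs \<in> good_walks r k \<and> same_shape xs zs. discovery_weight p xs / c zs)"
      unfolding class_r[OF xs] by (rule sum.cong) (auto simp: shape_class_def c_eq)
    finally show "discovery_weight p xs
        \<le> (\<Sum>zs | zs \<in> good_walks r k \<and> same_shape xs zs. discovery_weight p xs / c zs)" .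
  qed
  also have "\<dots> = (\<Sum>zs\<in>good_walks r k. \<Sum>xs | xs \<in> good_walks n k \<and> same_shape xs zs. discovery_weight p xs / c zs)"
    by (rule sum.swap_restrict) auto
  also have "\<dots> \<le> (\<Sum>zs\<in>good_walks r k. real n / real r)"
  proof (rule sum_mono)
    fix zs assume zs: "zs \<in> good_walks r k"
    have "(\<Sum>xs | xs \<in> good_walks n k \<and> same_shape xs zs. discovery_weight p xs / c zs)
        = (\<Sum>xs\<in>shape_class n zs. discovery_weight p xs) / c zs"
      unfolding class_n[OF zs] by (rule sum_divide_distrib[symmetric])
    also have "\<dots> \<le> (real n * D ^ (card (set zs) - 1)) / c zs"
      using c[of zs] good_walksD[OF zs] \<open>D > 0\<close>
      by (intro divide_right_mono sum_discovery_weight_shape_class_le nonneg D) auto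
    also have "\<dots> = real n / real r"
      using \<open>D > 0\<close> by (simp add: c_def)
    finally show "(\<Sum>xs | xs \<in> good_walks n k \<and> same_shape xs zs. discovery_weight p xs / c zs)
        \<le> real n / real r" .
  qed
  finally show ?thesis by (simp add: mult.commute)
qed

section \<open>Moments of the centred adjacency matrix\<close>

text \<open>
  The independent edge indicators behind \<open>inhom_random_graph\<close>, before they are turned into a
  relation.
\<close>

definition edge_pmf :: "nat \<Rightarrow> (nat \<Rightarrow> nat \<Rightarrow> real) \<Rightarrow> (nat \<times> nat \<Rightarrow> bool) pmf" where
  "edge_pmf n p = Pi_pmf (pairs n) False (\<lambda>(i, j). bernoulli_pmf (p i j))"

definition centered :: "(nat \<Rightarrow> nat \<Rightarrow> real) \<Rightarrow> (nat \<times> nat \<Rightarrow> bool) \<Rightarrow> nat \<Rightarrow> nat \<Rightarrow> real" where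
  "centered p X i j = of_bool (X (edge i j)) - case_prod p (edge i j)"

text \<open>
  The \<open>k\<close>-th central moment of a Bernoulli variable of parameter \<open>q\<close>.
\<close>

definition bernoulli_moment :: "real \<Rightarrow> nat \<Rightarrow> real" where
  "bernoulli_moment q k = q * (1 - q) ^ k + (1 - q) * (- q) ^ k"

lemma finite_set_edge_pmf: "finite (set_pmf (edge_pmf n p))"
proof (rule finite_subset)
  show "set_pmf (edge_pmf n p) \<subseteq> PiE_dflt (pairs n) False (\<lambda>_. UNIV)"
    unfolding edge_pmf_def by (auto simp: set_Pi_pmf PiE_dflt_def)
  show "finite (PiE_dflt (pairs n) False (\<lambda>_. UNIV :: bool set))"
    by (rule finite_PiE_dflt) auto
qed

lemma integrable_edge_pmf [simp]:
  fixes f :: "_ \<Rightarrow> real"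
  shows "integrable (measure_pmf (edge_pmf n p)) f"
  by (rule integrable_measure_pmf_finite[OF finite_set_edge_pmf])

lemma centered_symmetric: "centered p X i j = centered p X j i"
  by (simp add: centered_def edge_commute)

lemma expectation_edge_pmf_prod:
  fixes f :: "nat \<times> nat \<Rightarrow> bool \<Rightarrow> real"
  shows "measure_pmf.expectation (edge_pmf n p) (\<lambda>X. \<Prod>e\<in>pairs n. f e (X e))
    = (\<Prod>e\<in>pairs n. measure_pmf.expectation (bernoulli_pmf (case_prod p e)) (f e))"
proof -
  let ?\<mu> = "measure_pmf (edge_pmf n p)"
  have "prob_space.indep_vars ?\<mu> (\<lambda>_. borel) (\<lambda>e X. f e (X e)) (pairs n)"
    unfolding edge_pmf_def
    by (intro prob_space.indep_vars_compose2[OF _ indep_vars_Pi_pmf])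
       (auto simp: measure_pmf.prob_space_axioms)
  then have "(\<integral>X. (\<Prod>e\<in>pairs n. f e (X e)) \<partial>?\<mu>) = (\<Prod>e\<in>pairs n. \<integral>X. f e (X e) \<partial>?\<mu>)"
    by (intro prob_space.indep_vars_lebesgue_integral measure_pmf.prob_space_axioms) auto
  also have "\<dots> = (\<Prod>e\<in>pairs n. measure_pmf.expectation (bernoulli_pmf (case_prod p e)) (f e))"
  proof (rule prod.cong)
    fix e assume e: "e \<in> pairs n"
    have "(\<integral>X. f e (X e) \<partial>?\<mu>) = measure_pmf.expectation (map_pmf (\<lambda>X. X e) (edge_pmf n p)) (f e)"
      by simp
    also have "map_pmf (\<lambda>X. X e) (edge_pmf n p) = bernoulli_pmf (case_prod p e)"
      unfolding edge_pmf_def using e by (subst Pi_pmf_component) (auto simp: case_prod_unfold)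
    finally show "(\<integral>X. f e (X e) \<partial>?\<mu>) = measure_pmf.expectation (bernoulli_pmf (case_prod p e)) (f e)" .
  qed simp
  finally show ?thesis .
qed

lemma expectation_centered_power:
  assumes "0 \<le> q" "q \<le> 1"
  shows "measure_pmf.expectation (bernoulli_pmf q) (\<lambda>b. (of_bool b - q) ^ k) = bernoulli_moment q k"
  using assms by (simp add: bernoulli_moment_def mult_ac)

lemma expectation_walk_weight:
  assumes p: "\<And>i j. i \<in> {1..n} \<Longrightarrow> j \<in> {1..n} \<Longrightarrow> 0 \<le> p i j \<and> p i j \<le> 1"
    and xs: "set xs \<subseteq> {1..n}"
  shows "measure_pmf.expectation (edge_pmf n p) (\<lambda>X. walk_weight (centered p X) xs)
    = (\<Prod>e\<in>pairs n. bernoulli_moment (case_prod p e) (count_list (edges xs) e))"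
proof -
  have "walk_weight (centered p X) xs
      = (\<Prod>e\<in>pairs n. (of_bool (X e) - case_prod p e) ^ count_list (edges xs) e)" for X
    unfolding centered_def walk_weight_edge[of "\<lambda>e. of_bool (X e) - case_prod p e"]
    by (rule prod_list_eq_prod_count[OF set_edges_subset[OF xs] finite_pairs])
  then have "measure_pmf.expectation (edge_pmf n p) (\<lambda>X. walk_weight (centered p X) xs)
      = (\<Prod>e\<in>pairs n. measure_pmf.expectation (bernoulli_pmf (case_prod p e))
            (\<lambda>b. (of_bool b - case_prod p e) ^ count_list (edges xs) e))"
    using expectation_edge_pmf_prod[of n p "\<lambda>e b. (of_bool b - case_prod p e) ^ count_list (edges xs) e"]
    by simp
  also have "\<dots> = (\<Prod>e\<in>pairs n. bernoulli_moment (case_prod p e) (count_list (edges xs) e))"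
    by (intro prod.cong refl expectation_centered_power) (use p in \<open>auto simp: pairs_def\<close>)
  finally show ?thesis .
qed

lemma bernoulli_moment_0: "bernoulli_moment q 0 = 1"
  by (simp add: bernoulli_moment_def)

lemma bernoulli_moment_1: "bernoulli_moment q 1 = 0"
  by (simp add: bernoulli_moment_def)

text \<open>
  A centred Bernoulli variable is bounded by one, so its moments from the second on are at most its
  variance \<open>q (1 - q)\<close>, and the first moment is zero.
\<close>

lemma abs_bernoulli_moment_le:
  assumes q: "0 \<le> q" "q \<le> 1" and "k > 0"
  shows "\<bar>bernoulli_moment q k\<bar> \<le> q"
proof (cases "k = 1")
  case True
  then show ?thesis using q bernoulli_moment_1 by simp
next
  case False
  with \<open>k > 0\<close> have "k = Suc (Suc (k - 2))" by simp
  then obtain j where k: "k = Suc (Suc j)" ..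
  have "\<bar>bernoulli_moment q k\<bar> \<le> q * (1 - q) ^ k + (1 - q) * q ^ k"
    unfolding bernoulli_moment_def using q
    by (intro order_trans[OF abs_triangle_ineq]) (simp add: abs_mult power_abs)
  also have "\<dots> = q * ((1 - q) * ((1 - q) * (1 - q) ^ j + q * q ^ j))"
    by (simp add: k algebra_simps)
  also have "\<dots> \<le> q * (1 * ((1 - q) * 1 + q * 1))"
    using q by (intro mult_mono add_mono mult_left_mono power_le_one) auto
  finally show ?thesis by simp
qed

text \<open>
  All probabilities are at most one, so only one edge for each discovered vertex need be kept: the
  step that discovers a vertex uses an edge that was not used before.
\<close>

lemma prod_visited_le_discovery_weight:
  assumes P: "\<And>i j. i \<in> {1..n} \<Longrightarrow> j \<in> {1..n} \<Longrightarrow> 0 \<le> p i j \<and> p i j \<le> 1 \<and> p i j = p j i"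
    and xs: "set xs \<subseteq> {1..n}"
  shows "(\<Prod>e\<in>set (edges xs). case_prod p e) \<le> discovery_weight p xs"
  using xs
proof (induction xs rule: edges.induct)
  case (1 x y zs)
  let ?W = "\<Prod>e\<in>set (edges (y # zs)). case_prod p e"
  have IH: "?W \<le> discovery_weight p (y # zs)" using 1 by simp
  have pxy: "case_prod p (edge x y) = p x y"
    using 1 P by (auto simp: edge_def min_def max_def)
  have p01: "0 \<le> p x y" "p x y \<le> 1" using 1 P by auto
  have W: "0 \<le> ?W"
  proof (rule prod_nonneg)
    fix e assume "e \<in> set (edges (y # zs))"
    then have "e \<in> pairs n" using set_edges_subset[of "y # zs" n] 1 by auto
    then show "0 \<le> case_prod p e" using P by (auto simp: pairs_def)
  qed
  show ?case
  proof (cases "x \<in> set (y # zs)")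
    case True
    have "(\<Prod>e\<in>set (edges (x # y # zs)). case_prod p e) \<le> ?W"
    proof (cases "edge x y \<in> set (edges (y # zs))")
      case False
      then show ?thesis using pxy p01 W by (simp add: mult_left_le_one_le)
    qed (simp add: insert_absorb)
    with IH True show ?thesis by simp
  next
    case False
    then have "edge x y \<notin> set (edges (y # zs))"
      using edge_in_set_edgesD by blast
    then have "(\<Prod>e\<in>set (edges (x # y # zs)). case_prod p e) = p x y * ?W"
      using pxy by simp
    then show ?thesis using False IH p01 by (simp add: mult_left_mono)
  qed
qed auto

lemma prod_bernoulli_moment_le:
  assumes P: "\<And>i j. i \<in> {1..n} \<Longrightarrow> j \<in> {1..n} \<Longrightarrow> 0 \<le> p i j \<and> p i j \<le> 1 \<and> p i j = p j i"
    and xs: "set xs \<subseteq> {1..n}"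
  shows "(\<Prod>e\<in>pairs n. bernoulli_moment (case_prod p e) (count_list (edges xs) e))
      \<le> of_bool (no_single_edge xs) * discovery_weight p xs"
proof (cases "no_single_edge xs")
  case True
  let ?m = "\<lambda>e. bernoulli_moment (case_prod p e) (count_list (edges xs) e)"
  have p01: "0 \<le> case_prod p e \<and> case_prod p e \<le> 1" if "e \<in> pairs n" for e
    using that P by (auto simp: pairs_def)
  have "(\<Prod>e\<in>pairs n. ?m e) \<le> (\<Prod>e\<in>pairs n. \<bar>?m e\<bar>)"
    by (metis abs_ge_self abs_prod)
  also have "\<dots> = (\<Prod>e\<in>set (edges xs). \<bar>?m e\<bar>)"
    using set_edges_subset[OF xs] by (intro prod.mono_neutral_right) (auto simp: bernoulli_moment_0)
  also have "\<dots> \<le> (\<Prod>e\<in>set (edges xs). case_prod p e)"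
  proof (rule prod_mono)
    fix e assume e: "e \<in> set (edges xs)"
    then have "count_list (edges xs) e > 0" by (metis count_list_0_iff gr0I)
    moreover have "0 \<le> case_prod p e \<and> case_prod p e \<le> 1"
      using p01 set_edges_subset[OF xs] e by blast
    ultimately show "0 \<le> \<bar>?m e\<bar> \<and> \<bar>?m e\<bar> \<le> case_prod p e"
      by (intro conjI abs_ge_zero abs_bernoulli_moment_le) blast+
  qed
  also have "\<dots> \<le> discovery_weight p xs"
    by (rule prod_visited_le_discovery_weight[OF P xs])
  finally show ?thesis using True by simp
next
  case False
  then obtain e where e: "count_list (edges xs) e = 1"
    by (auto simp: no_single_edge_def)
  then have "e \<in> set (edges xs)" by (metis count_notin zero_neq_one)
  then have "e \<in> pairs n" using set_edges_subset[OF xs] by blast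
  then have "(\<Prod>e\<in>pairs n. bernoulli_moment (case_prod p e) (count_list (edges xs) e)) = 0"
    using e bernoulli_moment_1 by (intro prod_zero finite_pairs bexI[of _ e]) simp_all
  then show ?thesis by (simp only: False of_bool_eq mult_zero_left order_refl)
qed

lemma expectation_trace_pow_le:
  assumes P: "\<And>i j. i \<in> {1..n} \<Longrightarrow> j \<in> {1..n} \<Longrightarrow> 0 \<le> p i j \<and> p i j \<le> 1 \<and> p i j = p j i"
  shows "measure_pmf.expectation (edge_pmf n p) (\<lambda>X. trace_pow n (centered p X) k)
      \<le> (\<Sum>xs\<in>good_walks n k. discovery_weight p xs)"
proof -
  have "measure_pmf.expectation (edge_pmf n p) (\<lambda>X. trace_pow n (centered p X) k)
      = (\<Sum>xs\<in>closed_walks n k. measure_pmf.expectation (edge_pmf n p) (\<lambda>X. walk_weight (centered p X) xs))"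
    unfolding trace_pow_eq_sum_closed_walks by (rule Bochner_Integration.integral_sum) simp
  also have "\<dots> \<le> (\<Sum>xs\<in>closed_walks n k. of_bool (no_single_edge xs) * discovery_weight p xs)"
  proof (rule sum_mono)
    fix xs assume "xs \<in> closed_walks n k"
    then have xs: "set xs \<subseteq> {1..n}" by (auto simp: closed_walks_def walks_def)
    show "measure_pmf.expectation (edge_pmf n p) (\<lambda>X. walk_weight (centered p X) xs)
        \<le> of_bool (no_single_edge xs) * discovery_weight p xs"
      using expectation_walk_weight[of n p xs] prod_bernoulli_moment_le[OF P xs] P xs by simp
  qed
  also have "\<dots> = (\<Sum>xs\<in>good_walks n k. discovery_weight p xs)"
    unfolding good_walks_def by (rule sum.mono_neutral_cong_right) auto
  finally show ?thesis .
qed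

text \<open>
  The parameter \<open>1/3\<close> is chosen to make the variable skewed to the right: it takes the values
  \<open>2/3\<close> and \<open>-1/3\<close>, so the odd central moments beyond the first are positive as well. A
  symmetric comparison variable would miss the walks that use some edge an odd number of times.
\<close>

lemma bernoulli_moment_third_ge:
  assumes "k \<noteq> 1"
  shows "(1 / 3) ^ k \<le> bernoulli_moment (1 / 3) k"
proof -
  have eq: "bernoulli_moment (1 / 3) k = (1 / 3) ^ k * ((2 ^ k + 2 * (- 1) ^ k) / 3)"
    by (simp add: bernoulli_moment_def power_divide power_minus[of "1 / 3"] field_simps)
  have "(3::real) \<le> 2 ^ k + 2 * (- 1) ^ k"
  proof (cases "even k")
    case True
    then show ?thesis using one_le_power[of "2::real" k] by simp
  next
    case False
    with assms have "3 \<le> k" by presburger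
    then have "(2::real) ^ 3 \<le> 2 ^ k" by (rule power_increasing) simp
    then show ?thesis using False by simp
  qed
  then have "(1 / 3 :: real) ^ k * 1 \<le> (1 / 3) ^ k * ((2 ^ k + 2 * (- 1) ^ k) / 3)"
    by (intro mult_left_mono) auto
  then show ?thesis unfolding eq by simp
qed

text \<open>
  All walks have nonnegative expected weight in the dense graph, and a good walk has expected weight
  at least \<open>3\<^sup>-\<^sup>k\<close>, because the multiplicities of its edges sum to its length \<open>k\<close>.
\<close>

lemma card_good_walks_le:
  "real (card (good_walks r k))
    \<le> 3 ^ k * measure_pmf.expectation (edge_pmf r (\<lambda>_ _. 1 / 3)) (\<lambda>X. trace_pow r (centered (\<lambda>_ _. 1 / 3) X) k)"
proof -
  let ?p = "\<lambda>_ _. 1 / 3 :: real"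
  have weight: "of_bool (no_single_edge xs) * (1 / 3) ^ k
      \<le> measure_pmf.expectation (edge_pmf r ?p) (\<lambda>X. walk_weight (centered ?p X) xs)"
    if "xs \<in> closed_walks r k" for xs
  proof -
    have xs: "set xs \<subseteq> {1..r}" "length xs = Suc k"
      using that by (auto simp: closed_walks_def walks_def)
    let ?c = "count_list (edges xs)"
    have E: "measure_pmf.expectation (edge_pmf r ?p) (\<lambda>X. walk_weight (centered ?p X) xs)
        = (\<Prod>e\<in>pairs r. bernoulli_moment (1 / 3) (?c e))"
      by (subst expectation_walk_weight) (use xs in \<open>auto simp: case_prod_unfold\<close>)
    show ?thesis
    proof (cases "no_single_edge xs")
      case True
      have "(1 / 3) ^ k = (1 / 3 :: real) ^ (\<Sum>e\<in>pairs r. ?c e)"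
        using sum_count_set[OF set_edges_subset[OF xs(1)] finite_pairs] xs(2) by (simp add: length_edges)
      also have "\<dots> = (\<Prod>e\<in>pairs r. (1 / 3) ^ ?c e)"
        by (rule power_sum)
      also have "\<dots> \<le> (\<Prod>e\<in>pairs r. bernoulli_moment (1 / 3) (?c e))"
        using True by (intro prod_mono) (auto simp: no_single_edge_def intro!: bernoulli_moment_third_ge)
      finally show ?thesis using True E by simp
    next
      case False
      have "0 \<le> bernoulli_moment (1 / 3) m" for m
      proof (cases "m = 1")
        case False
        have "0 \<le> (1 / 3 :: real) ^ m" by simp
        also note bernoulli_moment_third_ge[OF False]
        finally show ?thesis .
      qed (simp add: bernoulli_moment_1[simplified])
      then have "0 \<le> (\<Prod>e\<in>pairs r. bernoulli_moment (1 / 3) (?c e))" by (intro prod_nonneg)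
      then show ?thesis using False E by simp
    qed
  qed
  have "real (card (good_walks r k)) * (1 / 3) ^ k
      = (\<Sum>xs\<in>closed_walks r k. of_bool (no_single_edge xs) * (1 / 3) ^ k)"
    unfolding good_walks_def
    by (simp add: sum_distrib_right[symmetric] Int_def)
  also have "\<dots> \<le> (\<Sum>xs\<in>closed_walks r k. measure_pmf.expectation (edge_pmf r ?p) (\<lambda>X. walk_weight (centered ?p X) xs))"
    by (intro sum_mono weight)
  also have "\<dots> = measure_pmf.expectation (edge_pmf r ?p) (\<lambda>X. trace_pow r (centered ?p X) k)"
    unfolding trace_pow_eq_sum_closed_walks by (rule Bochner_Integration.integral_sum[symmetric]) simp
  finally show ?thesis by (simp add: field_simps power_divide)
qed

section \<open>A grid that computes the spectral norm up to a factor\<close>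

text \<open>
  The points of the lattice of mesh \<open>1 / (4 \<surd>r)\<close> in the ball of radius \<open>5/4\<close>, which is a
  \<open>1/4\<close>-net of the unit ball. The bounds on the single integer coordinates follow from the bound on
  their squares and are there to make the set visibly finite.
\<close>

definition grid :: "nat \<Rightarrow> (nat \<Rightarrow> real) set" where
  "grid r = (\<lambda>z i. real_of_int (z i) / (4 * sqrt (real r))) `
     {z \<in> {1..r} \<rightarrow>\<^sub>E {- int (5 * r)..int (5 * r)}. (\<Sum>i=1..r. (z i)\<^sup>2) \<le> 25 * int r}"

lemma finite_grid [simp]: "finite (grid r)"
proof -
  have "finite ({1..r} \<rightarrow>\<^sub>E {- int (5 * r)..int (5 * r)})"
    by (intro finite_PiE) auto
  then show ?thesis unfolding grid_def by simp
qed

lemma L2_set_square: "(L2_set x A)\<^sup>2 = (\<Sum>i\<in>A. (x i)\<^sup>2)"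
  by (simp add: L2_set_def sum_nonneg)

lemma L2_set_grid_le: "y \<in> grid r \<Longrightarrow> L2_set y {1..r} \<le> 5 / 4"
proof -
  assume "y \<in> grid r"
  then obtain z where y: "y = (\<lambda>i. real_of_int (z i) / (4 * sqrt (real r)))"
    and z: "(\<Sum>i=1..r. (z i)\<^sup>2) \<le> 25 * int r"
    by (auto simp: grid_def)
  have "real_of_int (\<Sum>i=1..r. (z i)\<^sup>2) \<le> real_of_int (25 * int r)"
    using z by (simp only: of_int_le_iff)
  then have "(\<Sum>i=1..r. (real_of_int (z i))\<^sup>2) \<le> 25 * real r" by simp
  then have "(\<Sum>i=1..r. (y i)\<^sup>2) \<le> 25 / 16"
    by (cases "r = 0") (simp_all add: y power_divide power_mult_distrib divide_simps flip: sum_divide_distrib)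
  then have "L2_set y {1..r} \<le> sqrt (25 / 16)"
    unfolding L2_set_def by (rule real_sqrt_le_mono)
  also have "sqrt (25 / 16) = 5 / (4 :: real)"
    by (simp add: real_sqrt_divide)
  finally show ?thesis .
qed

text \<open>
  Rounding the coordinates of \<open>4 \<surd>r x\<close> down moves each by at most one, hence the vector by at most
  \<open>\<surd>r\<close> in norm.
\<close>

lemma grid_approx:
  assumes x: "L2_set x {1..r} \<le> 1" and r: "r \<ge> 1"
  obtains y where "y \<in> grid r" "L2_set (\<lambda>i. x i - y i) {1..r} \<le> 1 / 4"
proof -
  define s where "s = 4 * sqrt (real r)"
  have s: "s > 0" using r by (simp add: s_def)
  have s2: "s\<^sup>2 = 16 * real r" by (simp add: s_def power_mult_distrib)
  define z where "z = (\<lambda>i. if i \<in> {1..r} then \<lfloor>s * x i\<rfloor> else undefined)"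
  define y where "y = (\<lambda>i. real_of_int (z i) / s)"
  have diff: "(s * x i - real_of_int (z i))\<^sup>2 \<le> 1" if "i \<in> {1..r}" for i
  proof -
    have "z i = \<lfloor>s * x i\<rfloor>" using that by (auto simp: z_def)
    then have "\<bar>s * x i - real_of_int (z i)\<bar> \<le> 1" by linarith
    then show ?thesis by (simp add: abs_square_le_1)
  qed
  then have "(\<Sum>i=1..r. (s * x i - real_of_int (z i))\<^sup>2) \<le> (\<Sum>i=1..r. 1)"
    by (intro sum_mono)
  then have d: "L2_set (\<lambda>i. s * x i - real_of_int (z i)) {1..r} \<le> sqrt (real r)"
    unfolding L2_set_def by simp
  have "(\<lambda>i. x i - y i) = (\<lambda>i. (1 / s) * (s * x i - real_of_int (z i)))"
    using s by (auto simp: y_def field_simps)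
  then have "L2_set (\<lambda>i. x i - y i) {1..r} = (1 / s) * L2_set (\<lambda>i. s * x i - real_of_int (z i)) {1..r}"
    using s by (simp only: L2_set_scale) simp
  also have "\<dots> \<le> (1 / s) * sqrt (real r)"
    using s d by (intro mult_left_mono) auto
  also have "\<dots> = 1 / 4" using s by (simp add: s_def)
  finally have near: "L2_set (\<lambda>i. x i - y i) {1..r} \<le> 1 / 4" .
  have "L2_set (\<lambda>i. real_of_int (z i)) {1..r}
      = L2_set (\<lambda>i. s * x i + (-1) * (s * x i - real_of_int (z i))) {1..r}"
    by simp
  also have "\<dots> \<le> L2_set (\<lambda>i. s * x i) {1..r} + L2_set (\<lambda>i. (-1) * (s * x i - real_of_int (z i))) {1..r}"
    by (rule L2_set_triangle_ineq)
  also have "\<dots> \<le> s * 1 + sqrt (real r)"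
    unfolding L2_set_scale using d x s by (intro add_mono) auto
  also have "\<dots> = 5 * sqrt (real r)" by (simp add: s_def)
  finally have "(L2_set (\<lambda>i. real_of_int (z i)) {1..r})\<^sup>2 \<le> (5 * sqrt (real r))\<^sup>2"
    by (intro power_mono) auto
  then have "(\<Sum>i=1..r. (real_of_int (z i))\<^sup>2) \<le> 25 * real r"
    by (simp add: L2_set_square power_mult_distrib)
  then have "real_of_int (\<Sum>i=1..r. (z i)\<^sup>2) \<le> real_of_int (25 * int r)" by simp
  then have sum: "(\<Sum>i=1..r. (z i)\<^sup>2) \<le> 25 * int r" by (simp only: of_int_le_iff)
  have "z i \<in> {- int (5 * r)..int (5 * r)}" if "i \<in> {1..r}" for i
  proof -
    have "(z i)\<^sup>2 \<le> (\<Sum>i=1..r. (z i)\<^sup>2)"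
      using that by (intro member_le_sum) auto
    also have "\<dots> \<le> 25 * int r" by (rule sum)
    also have "\<dots> \<le> 25 * int r * int r" using r by simp
    also have "\<dots> = (int (5 * r))\<^sup>2" by (simp add: power2_eq_square)
    finally have "\<bar>z i\<bar> \<le> \<bar>int (5 * r)\<bar>" by (simp only: abs_le_square_iff)
    then show ?thesis by auto
  qed
  then have "z \<in> {1..r} \<rightarrow>\<^sub>E {- int (5 * r)..int (5 * r)}"
    by (auto simp: z_def PiE_def extensional_def)
  then have "y \<in> grid r"
    unfolding grid_def y_def s_def using sum by blast
  with near that show ?thesis by blast
qed

lemma sum_half_power_abs:
  "(\<Sum>z\<in>{- int k..int k}. (1 / 2 :: real) ^ nat \<bar>z\<bar>) = 3 - 2 * (1 / 2) ^ k"
proof (induction k)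
  case (Suc k)
  have "{- int (Suc k)..int (Suc k)} = insert (int (Suc k)) (insert (- int (Suc k)) {- int k..int k})"
    by auto
  then show ?case using Suc by (simp add: nat_add_distrib)
qed simp

text \<open>
  An exponential Chebyshev bound for counting: the weight \<open>2\<^sup>2\<^sup>5\<^sup>r 2\<^sup>-\<^sup>|\<^sup>z\<^sup>|\<close>, where \<open>|z|\<close> is the sum of the
  squared coordinates, is at least one on the ball \<open>|z| \<le> 25 r\<close>, and its sum over the whole
  box factorizes into \<open>r\<close> sums dominated by geometric series.
\<close>

lemma card_grid_le: "real (card (grid r)) \<le> (2 ^ 27) ^ r"
proof -
  let ?B = "{- int (5 * r)..int (5 * r)}"
  let ?Z = "{z \<in> {1..r} \<rightarrow>\<^sub>E ?B. (\<Sum>i=1..r. (z i)\<^sup>2) \<le> 25 * int r}"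
  let ?w = "\<lambda>z::int. 2 ^ 25 * (1 / 2 :: real) ^ nat (z\<^sup>2)"
  have fin: "finite ({1..r} \<rightarrow>\<^sub>E ?B)" by (intro finite_PiE) auto
  have "real (card (grid r)) \<le> real (card ?Z)"
    unfolding grid_def using fin by (intro of_nat_mono card_image_le) auto
  also have "\<dots> = (\<Sum>z\<in>?Z. 1)" by simp
  also have "\<dots> \<le> (\<Sum>z\<in>?Z. \<Prod>i=1..r. ?w (z i))"
  proof (rule sum_mono)
    fix z assume z: "z \<in> ?Z"
    have "int (\<Sum>i=1..r. nat ((z i)\<^sup>2)) = (\<Sum>i=1..r. (z i)\<^sup>2)" by simp
    also have "\<dots> \<le> int (25 * r)" using z by simp
    finally have le: "(\<Sum>i=1..r. nat ((z i)\<^sup>2)) \<le> 25 * r" by (simp only: of_nat_le_iff)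
    have "1 = (2 ^ 25) ^ r * (1 / 2 :: real) ^ (25 * r)"
      by (simp add: power_mult power_divide flip: power_mult_distrib)
    also have "\<dots> \<le> (2 ^ 25) ^ r * (1 / 2) ^ (\<Sum>i=1..r. nat ((z i)\<^sup>2))"
      by (intro mult_left_mono power_decreasing le) auto
    also have "\<dots> = (\<Prod>i=1..r. ?w (z i))"
      by (simp add: prod.distrib power_sum)
    finally show "1 \<le> (\<Prod>i=1..r. ?w (z i))" .
  qed
  also have "\<dots> \<le> (\<Sum>z\<in>{1..r} \<rightarrow>\<^sub>E ?B. \<Prod>i=1..r. ?w (z i))"
    using fin by (intro sum_mono2) (auto intro!: prod_nonneg)
  also have "\<dots> = (\<Prod>i=1..r. \<Sum>z\<in>?B. ?w z)"
    by (rule prod_sum_PiE[symmetric]) auto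
  also have "\<dots> \<le> (\<Prod>i=1..r. 2 ^ 27)"
  proof (rule prod_mono, intro conjI)
    have "(\<Sum>z\<in>?B. ?w z) \<le> (\<Sum>z\<in>?B. 2 ^ 25 * (1 / 2) ^ nat \<bar>z\<bar>)"
    proof (intro sum_mono mult_left_mono power_decreasing nat_mono)
      fix z :: int
      show "\<bar>z\<bar> \<le> z\<^sup>2"
        by (cases "z = 0") (use mult_left_mono[of 1 "\<bar>z\<bar>" "\<bar>z\<bar>"] in \<open>auto simp: power2_eq_square\<close>)
    qed auto
    also have "\<dots> = 2 ^ 25 * (3 - 2 * (1 / 2) ^ (5 * r))"
      by (simp only: sum_distrib_left[symmetric] sum_half_power_abs)
    also have "\<dots> \<le> 2 ^ 25 * 4"
    proof (rule mult_left_mono)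
      have "0 \<le> (1 / 2 :: real) ^ (5 * r)" by simp
      then show "3 - 2 * (1 / 2) ^ (5 * r) \<le> (4 :: real)" by linarith
    qed simp
    finally show "(\<Sum>z\<in>?B. ?w z) \<le> 2 ^ 27" by simp
  qed (auto intro: sum_nonneg)
  finally show ?thesis by simp
qed

text \<open>
  Approximating both arguments of the bilinear form by grid points loses a factor \<open>4/3\<close> each, in
  total \<open>16/9 \<le> 2\<close>.
\<close>

lemma spectral_norm_le_grid:
  assumes r: "r \<ge> 1"
  obtains x y where "x \<in> grid r" "y \<in> grid r"
    "spectral_norm r M \<le> 2 * (\<Sum>i=1..r. x i * mat_vec r M y i)"
proof -
  let ?S = "spectral_norm r M"
  define b where "b = (\<lambda>(x, y). \<Sum>i=1..r. x i * mat_vec r M y i)"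
  have "grid r \<noteq> {}"
    using grid_approx[of "\<lambda>_. 0" r] r by (force simp: L2_set_def)
  then have fin: "finite (b ` (grid r \<times> grid r))" "b ` (grid r \<times> grid r) \<noteq> {}" by auto
  define B where "B = Max (b ` (grid r \<times> grid r))"
  have w: "3 / 4 * L2_set (mat_vec r M y) {1..r} \<le> B" if y: "y \<in> grid r" for y
  proof -
    let ?w = "mat_vec r M y"
    define c where "c = L2_set ?w {1..r}"
    have c: "c \<ge> 0" by (simp add: c_def)
    \<comment> \<open>For \<open>c = 0\<close> this is the zero vector, and the equation \<open>\<langle>u, w\<rangle> = c\<close> below still holds.\<close>
    define u where "u = (\<lambda>i. (1 / c) * ?w i)"
    have u: "L2_set u {1..r} \<le> 1"
      unfolding u_def L2_set_scale c_def[symmetric] using c by (cases "c = 0") auto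
    have "(\<Sum>i=1..r. u i * ?w i) = (1 / c) * (\<Sum>i=1..r. (?w i)\<^sup>2)"
      by (simp add: u_def sum_divide_distrib power2_eq_square)
    also have "\<dots> = c"
      unfolding L2_set_square[symmetric] c_def[symmetric] by (simp add: power2_eq_square)
    finally have uw: "(\<Sum>i=1..r. u i * ?w i) = c" .
    obtain x where x: "x \<in> grid r" "L2_set (\<lambda>i. u i - x i) {1..r} \<le> 1 / 4"
      using grid_approx[OF u r] .
    have "c = (\<Sum>i=1..r. u i * ?w i)" by (rule uw[symmetric])
    also have "\<dots> = b (x, y) + (\<Sum>i=1..r. (u i - x i) * ?w i)"
      unfolding b_def prod.case sum.distrib[symmetric] by (rule sum.cong) (simp_all add: algebra_simps)
    also have "\<dots> \<le> B + 1 / 4 * c"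
    proof (rule add_mono)
      show "b (x, y) \<le> B"
        unfolding B_def by (rule Max_ge[OF fin(1)]) (use x(1) y in blast)
      have "(\<Sum>i=1..r. (u i - x i) * ?w i) \<le> L2_set (\<lambda>i. u i - x i) {1..r} * c"
        unfolding c_def by (rule order_trans[OF abs_ge_self sum_mult_le_L2_set])
      also have "\<dots> \<le> 1 / 4 * c" by (rule mult_right_mono[OF x(2) c])
      finally show "(\<Sum>i=1..r. (u i - x i) * ?w i) \<le> 1 / 4 * c" .
    qed
    finally show ?thesis by (simp add: c_def)
  qed
  have "?S \<le> 4 / 3 * B + 1 / 4 * ?S"
  proof (rule spectral_norm_leI)
    fix v :: "nat \<Rightarrow> real" assume v: "L2_set v {1..r} \<le> 1"
    obtain y where y: "y \<in> grid r" "L2_set (\<lambda>i. v i - y i) {1..r} \<le> 1 / 4"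
      using grid_approx[OF v r] .
    have "mat_vec r M v = (\<lambda>i. mat_vec r M y i + mat_vec r M (\<lambda>i. v i - y i) i)"
      using mat_vec_add[of r M y "\<lambda>i. v i - y i"] by simp
    then have "L2_set (mat_vec r M v) {1..r}
        \<le> L2_set (mat_vec r M y) {1..r} + L2_set (mat_vec r M (\<lambda>i. v i - y i)) {1..r}"
      using L2_set_triangle_ineq by metis
    moreover have "L2_set (mat_vec r M (\<lambda>i. v i - y i)) {1..r} \<le> ?S * (1 / 4)"
      by (rule order_trans[OF L2_set_mat_vec_le mult_left_mono[OF y(2) spectral_norm_nonneg]])
    ultimately show "L2_set (mat_vec r M v) {1..r} \<le> 4 / 3 * B + 1 / 4 * ?S"
      using w[OF y(1)] by linarith
  qed
  moreover have "0 \<le> B"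
  proof -
    obtain y where "y \<in> grid r" using \<open>grid r \<noteq> {}\<close> by blast
    then show ?thesis using w[of y] L2_set_nonneg[of "mat_vec r M y" "{1..r}"] by linarith
  qed
  ultimately have "?S \<le> 2 * B" by linarith
  moreover have "B \<in> b ` (grid r \<times> grid r)"
    unfolding B_def by (rule Max_in[OF fin])
  ultimately show ?thesis using that by (auto simp: b_def)
qed

lemma spectral_norm_power_le_grid:
  assumes "r \<ge> 1"
  shows "spectral_norm r M ^ (2 * q)
    \<le> 4 ^ q * (\<Sum>x\<in>grid r. \<Sum>y\<in>grid r. (\<Sum>i=1..r. x i * mat_vec r M y i) ^ (2 * q))"
proof -
  let ?b = "\<lambda>x y. \<Sum>i=1..r. x i * mat_vec r M y i"
  obtain x y where xy: "x \<in> grid r" "y \<in> grid r" "spectral_norm r M \<le> 2 * ?b x y"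
    using spectral_norm_le_grid[OF assms] .
  have "spectral_norm r M ^ (2 * q) \<le> (2 * ?b x y) ^ (2 * q)"
    by (rule power_mono[OF xy(3) spectral_norm_nonneg])
  also have "\<dots> = 4 ^ q * ?b x y ^ (2 * q)"
    by (simp add: power_mult_distrib power_mult)
  also have "\<dots> \<le> 4 ^ q * (\<Sum>x\<in>grid r. \<Sum>y\<in>grid r. ?b x y ^ (2 * q))"
  proof (rule mult_left_mono)
    have "?b x y ^ (2 * q) \<le> (\<Sum>y\<in>grid r. ?b x y ^ (2 * q))"
      using xy by (intro member_le_sum) (auto simp: power_mult)
    also have "\<dots> \<le> (\<Sum>x\<in>grid r. \<Sum>y\<in>grid r. ?b x y ^ (2 * q))"
      using xy by (intro member_le_sum[of x _ "\<lambda>x. \<Sum>y\<in>grid r. ?b x y ^ (2 * q)"])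
        (auto simp: power_mult intro!: sum_nonneg)
    finally show "?b x y ^ (2 * q) \<le> (\<Sum>x\<in>grid r. \<Sum>y\<in>grid r. ?b x y ^ (2 * q))" .
  qed simp
  finally show ?thesis .
qed

section \<open>The norm of the dense comparison matrix\<close>

text \<open>
  The linear term is kept separate, so that it drops out in expectation for a centred variable.
\<close>

lemma exp_le_add_exp_square: "exp x \<le> x + exp (x\<^sup>2)" for x :: real
proof -
  have sq: "1 + x\<^sup>2 \<le> exp (x\<^sup>2)" by (rule exp_ge_add_one_self)
  consider "x \<ge> 1" | "0 \<le> x" "x \<le> 1" | "x \<le> 0" by linarith
  then show ?thesis
  proof cases
    case 1
    then have "x \<le> x\<^sup>2" by (simp add: power2_eq_square)
    then have "exp x \<le> exp (x\<^sup>2)" by simp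
    then show ?thesis using 1 by linarith
  next
    case 2
    then have "exp x \<le> 1 + x + x\<^sup>2" by (intro exp_bound)
    also have "\<dots> = x + (1 + x\<^sup>2)" by simp
    also have "\<dots> \<le> x + exp (x\<^sup>2)" by (rule add_left_mono[OF sq])
    finally show ?thesis .
  next
    case 3
    define y where "y = - x"
    have y: "y \<ge> 0" using 3 by (simp add: y_def)
    have "1 \<le> 1 + y\<^sup>2 / 2 + y ^ 3 / 2 + y ^ 4 / 2"
      using y by simp
    also have "\<dots> = (1 - y + y\<^sup>2) * (1 + y + y\<^sup>2 / 2)"
      by (simp add: field_simps power2_eq_square power3_eq_cube power4_eq_xxxx)
    also have "\<dots> \<le> (1 - y + y\<^sup>2) * exp y"
    proof (rule mult_left_mono[OF exp_lower_Taylor_quadratic[OF y]])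
      have "1 - y + y\<^sup>2 = (1 / 2 - y)\<^sup>2 + 3 / 4" by (simp add: power2_eq_square field_simps)
      then show "0 \<le> 1 - y + y\<^sup>2" by simp
    qed
    finally have "exp (- y) \<le> 1 - y + y\<^sup>2"
      by (simp add: exp_minus field_simps)
    then have "exp x \<le> x + (1 + x\<^sup>2)" by (simp add: y_def)
    also have "\<dots> \<le> x + exp (x\<^sup>2)" by (rule add_left_mono[OF sq])
    finally show ?thesis .
  qed
qed

lemma expectation_exp_bernoulli_third:
  fixes t :: real
  shows "measure_pmf.expectation (bernoulli_pmf (1 / 3)) (\<lambda>b. exp (t * (of_bool b - 1 / 3))) \<le> exp (t\<^sup>2)"
proof -
  have "measure_pmf.expectation (bernoulli_pmf (1 / 3)) (\<lambda>b. exp (t * (of_bool b - 1 / 3)))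
      = 1 / 3 * exp (2 * t / 3) + 2 / 3 * exp (- t / 3)"
    by (simp add: field_simps)
  also have "\<dots> \<le> 1 / 3 * (2 * t / 3 + exp ((2 * t / 3)\<^sup>2)) + 2 / 3 * (- t / 3 + exp ((- t / 3)\<^sup>2))"
    by (intro add_mono mult_left_mono exp_le_add_exp_square) auto
  also have "\<dots> = 1 / 3 * exp ((2 * t / 3)\<^sup>2) + 2 / 3 * exp ((- t / 3)\<^sup>2)"
    by (simp add: field_simps)
  also have "\<dots> \<le> 1 / 3 * exp (t\<^sup>2) + 2 / 3 * exp (t\<^sup>2)"
    by (intro add_mono mult_left_mono) (auto simp: power_divide power_mult_distrib)
  finally show ?thesis by simp
qed

text \<open>
  This folds a double sum along the diagonal, to express it in the independent entries on and
  above the diagonal.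
\<close>

lemma sum_square_eq_sum_pairs:
  fixes h :: "nat \<Rightarrow> nat \<Rightarrow> real"
  shows "(\<Sum>i=1..r. \<Sum>j=1..r. h i j) = (\<Sum>(i, j)\<in>pairs r. if i = j then h i i else h i j + h j i)"
proof -
  let ?U = "{(i, j). 1 \<le> i \<and> i < j \<and> j \<le> r}"
  have U: "?U \<subseteq> pairs r" by (auto simp: pairs_def)
  have "(\<Sum>i=1..r. \<Sum>j=1..r. h i j) = (\<Sum>(i, j)\<in>{1..r} \<times> {1..r}. h i j)"
    by (rule sum.cartesian_product)
  also have "{1..r} \<times> {1..r} = pairs r \<union> prod.swap ` ?U"
    by (auto simp: pairs_def image_iff)
  also have "(\<Sum>(i, j)\<in>\<dots>. h i j) = (\<Sum>(i, j)\<in>pairs r. h i j) + (\<Sum>(i, j)\<in>prod.swap ` ?U. h i j)"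
    using finite_subset[OF U finite_pairs]
    by (intro sum.union_disjoint finite_pairs finite_imageI) (auto simp: pairs_def)
  also have "(\<Sum>(i, j)\<in>prod.swap ` ?U. h i j) = (\<Sum>(i, j)\<in>?U. h j i)"
    by (subst sum.reindex) (auto simp: case_prod_unfold)
  also have "(\<Sum>(i, j)\<in>?U. h j i) = (\<Sum>(i, j)\<in>pairs r. if i = j then 0 else h j i)"
    by (rule sum.mono_neutral_cong_left[OF finite_pairs U]) (auto simp: pairs_def split: if_splits)
  also have "(\<Sum>(i, j)\<in>pairs r. h i j) + (\<Sum>(i, j)\<in>pairs r. if i = j then 0 else h j i)
      = (\<Sum>(i, j)\<in>pairs r. if i = j then h i i else h i j + h j i)"
    unfolding sum.distrib[symmetric] by (rule sum.cong) auto
  finally show ?thesis .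
qed

definition bilinear :: "nat \<Rightarrow> (nat \<Rightarrow> nat \<Rightarrow> real) \<Rightarrow> (nat \<Rightarrow> real) \<Rightarrow> (nat \<Rightarrow> real) \<Rightarrow> real" where
  "bilinear r M x y = (\<Sum>i=1..r. x i * mat_vec r M y i)"

lemma bilinear_scale: "bilinear r M (\<lambda>i. s * x i) y = s * bilinear r M x y"
  by (simp add: bilinear_def sum_distrib_left mult.assoc)

lemma expectation_exp_bilinear:
  "measure_pmf.expectation (edge_pmf r (\<lambda>_ _. 1 / 3))
      (\<lambda>X. exp (bilinear r (centered (\<lambda>_ _. 1 / 3) X) x y))
    \<le> exp (2 * (L2_set x {1..r})\<^sup>2 * (L2_set y {1..r})\<^sup>2)"
proof -
  let ?p = "\<lambda>_ _. 1 / 3 :: real"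
  define c where "c = (\<lambda>(i, j). if i = j then x i * y i else x i * y j + x j * y i)"
  have form: "bilinear r (centered ?p X) x y = (\<Sum>e\<in>pairs r. c e * (of_bool (X e) - 1 / 3))" for X
  proof -
    have "bilinear r (centered ?p X) x y = (\<Sum>i=1..r. \<Sum>j=1..r. x i * centered ?p X i j * y j)"
      by (simp add: bilinear_def mat_vec_def sum_distrib_left mult.assoc)
    also have "\<dots> = (\<Sum>e\<in>pairs r. c e * (of_bool (X e) - 1 / 3))"
      unfolding sum_square_eq_sum_pairs
      by (rule sum.cong) (auto simp: c_def centered_def edge_def pairs_def field_simps)
    finally show ?thesis .
  qed
  have "measure_pmf.expectation (edge_pmf r ?p) (\<lambda>X. exp (bilinear r (centered ?p X) x y))
      = measure_pmf.expectation (edge_pmf r ?p) (\<lambda>X. \<Prod>e\<in>pairs r. exp (c e * (of_bool (X e) - 1 / 3)))"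
    unfolding form by (simp add: exp_sum)
  also have "\<dots> = (\<Prod>e\<in>pairs r. measure_pmf.expectation (bernoulli_pmf (1 / 3)) (\<lambda>b. exp (c e * (of_bool b - 1 / 3))))"
    using expectation_edge_pmf_prod[of r ?p "\<lambda>e b. exp (c e * (of_bool b - 1 / 3))"]
    by (simp only: case_prod_unfold)
  also have "\<dots> \<le> (\<Prod>e\<in>pairs r. exp ((c e)\<^sup>2))"
    by (intro prod_mono conjI expectation_exp_bernoulli_third integral_nonneg_AE) auto
  also have "\<dots> = exp (\<Sum>e\<in>pairs r. (c e)\<^sup>2)"
    by (simp add: exp_sum)
  also have "\<dots> \<le> exp (2 * (L2_set x {1..r})\<^sup>2 * (L2_set y {1..r})\<^sup>2)"
  proof -
    let ?h = "\<lambda>i j. (x i)\<^sup>2 * (y j)\<^sup>2"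
    have "(\<Sum>e\<in>pairs r. (c e)\<^sup>2)
        \<le> (\<Sum>e\<in>pairs r. 2 * (case e of (i, j) \<Rightarrow> if i = j then ?h i i else ?h i j + ?h j i))"
    proof (rule sum_mono)
      fix e :: "nat \<times> nat"
      obtain i j where e: "e = (i, j)" by (cases e)
      have "(x i * y j + x j * y i)\<^sup>2 \<le> 2 * ((x i * y j)\<^sup>2 + (x j * y i)\<^sup>2)"
        using sum_squares_bound[of "x i * y j" "x j * y i"] by (simp add: power2_sum)
      then show "(c e)\<^sup>2 \<le> 2 * (case e of (i, j) \<Rightarrow> if i = j then ?h i i else ?h i j + ?h j i)"
        by (auto simp: c_def e power_mult_distrib)
    qed
    also have "\<dots> = 2 * (\<Sum>i=1..r. \<Sum>j=1..r. ?h i j)"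
      unfolding sum_square_eq_sum_pairs[of ?h] by (simp add: sum_distrib_left)
    also have "\<dots> = 2 * (L2_set x {1..r})\<^sup>2 * (L2_set y {1..r})\<^sup>2"
      by (simp add: L2_set_square sum_product)
    finally show ?thesis by simp
  qed
  finally show ?thesis .
qed

text \<open>
  Raise \<open>t \<le> e\<^sup>t\<close> for \<open>t = |a| / 2q\<close> to the power \<open>2q\<close>.
\<close>

lemma even_power_le_exp:
  fixes a :: real
  assumes "q \<ge> 1"
  shows "a ^ (2 * q) \<le> (2 * real q) ^ (2 * q) * (exp a + exp (- a))"
proof -
  let ?L = "2 * real q"
  have L: "?L > 0" using assms by simp
  have "\<bar>a\<bar> / ?L \<le> exp (\<bar>a\<bar> / ?L)"
    using exp_ge_add_one_self[of "\<bar>a\<bar> / ?L"] by linarith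
  then have "(\<bar>a\<bar> / ?L) ^ (2 * q) \<le> exp (\<bar>a\<bar> / ?L) ^ (2 * q)"
    using L by (intro power_mono) auto
  also have "\<dots> = exp \<bar>a\<bar>"
    using L by (simp flip: exp_of_nat_mult)
  also have "\<dots> \<le> exp a + exp (- a)"
    by (cases "a \<ge> 0") auto
  finally have "\<bar>a\<bar> ^ (2 * q) \<le> ?L ^ (2 * q) * (exp a + exp (- a))"
    using L by (simp add: power_divide field_simps)
  then show ?thesis by (simp add: power_mult)
qed

text \<open>
  The exponential moment at \<open>\<plusminus>\<surd>q\<close> is at most \<open>e\<^sup>5\<^sup>q\<close>, and this choice balances it against the factor
  \<open>(2q)\<^sup>2\<^sup>q q\<^sup>-\<^sup>q = (4q)\<^sup>q\<close> that is lost in passing from powers to exponentials.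
\<close>

lemma expectation_bilinear_power:
  assumes x: "L2_set x {1..r} \<le> 5 / 4" and y: "L2_set y {1..r} \<le> 5 / 4" and q: "q \<ge> 1"
  shows "measure_pmf.expectation (edge_pmf r (\<lambda>_ _. 1 / 3))
      (\<lambda>X. bilinear r (centered (\<lambda>_ _. 1 / 3) X) x y ^ (2 * q)) \<le> (8 * exp 5 * real q) ^ q"
proof -
  let ?p = "\<lambda>_ _. 1 / 3 :: real"
  let ?E = "measure_pmf.expectation (edge_pmf r ?p)"
  let ?b = "\<lambda>X. bilinear r (centered ?p X) x y"
  define s where "s = sqrt (real q)"
  have s: "s > 0" "s\<^sup>2 = real q" using q by (auto simp: s_def)
  have xy: "(L2_set x {1..r})\<^sup>2 * (L2_set y {1..r})\<^sup>2 \<le> (5 / 4)\<^sup>2 * (5 / 4)\<^sup>2"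
    using x y by (intro mult_mono power_mono) auto
  have mgf: "?E (\<lambda>X. exp (t * ?b X)) \<le> exp (5 * real q)" if "t\<^sup>2 = real q" for t
  proof -
    have "?E (\<lambda>X. exp (t * ?b X)) \<le> exp (2 * (\<bar>t\<bar> * L2_set x {1..r})\<^sup>2 * (L2_set y {1..r})\<^sup>2)"
      using expectation_exp_bilinear[of r "\<lambda>i. t * x i" y] by (simp only: bilinear_scale L2_set_scale)
    also have "2 * (\<bar>t\<bar> * L2_set x {1..r})\<^sup>2 * (L2_set y {1..r})\<^sup>2
        = 2 * real q * ((L2_set x {1..r})\<^sup>2 * (L2_set y {1..r})\<^sup>2)"
      using that by (simp add: power_mult_distrib)
    also have "exp \<dots> \<le> exp (2 * real q * ((5 / 4)\<^sup>2 * (5 / 4)\<^sup>2))"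
      unfolding exp_le_cancel_iff using xy by (intro mult_left_mono) auto
    also have "\<dots> \<le> exp (5 * real q)"
      unfolding exp_le_cancel_iff by (simp add: power2_eq_square)
    finally show ?thesis .
  qed
  have pw: "(2 * real q) ^ (2 * q) = real q ^ q * (4 * real q) ^ q"
    by (simp add: power_mult power_mult_distrib power2_eq_square)
  have "real q ^ q * ?E (\<lambda>X. ?b X ^ (2 * q)) = ?E (\<lambda>X. (s * ?b X) ^ (2 * q))"
    by (simp add: power_mult_distrib power_mult s)
  also have "\<dots> \<le> ?E (\<lambda>X. (2 * real q) ^ (2 * q) * (exp (s * ?b X) + exp (- (s * ?b X))))"
    by (intro integral_mono even_power_le_exp q) auto
  also have "\<dots> = (2 * real q) ^ (2 * q) * (?E (\<lambda>X. exp (s * ?b X)) + ?E (\<lambda>X. exp ((- s) * ?b X)))"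
    by simp
  also have "\<dots> \<le> (2 * real q) ^ (2 * q) * (exp (5 * real q) + exp (5 * real q))"
    by (intro mult_left_mono add_mono mgf) (auto simp: s)
  also have "\<dots> = real q ^ q * ((4 * real q) ^ q * (2 * exp 5 ^ q))"
    unfolding pw exp_of_nat2_mult by (simp only: mult_2[symmetric] mult_ac)
  finally have "?E (\<lambda>X. ?b X ^ (2 * q)) \<le> (4 * real q) ^ q * (2 * exp 5 ^ q)"
    using q by (subst (asm) mult_le_cancel_left_pos) auto
  also have "\<dots> \<le> (4 * real q) ^ q * (2 ^ q * exp 5 ^ q)"
    using q by (intro mult_left_mono mult_right_mono self_le_power) auto
  also have "\<dots> = (8 * exp 5 * real q) ^ q"
  proof -
    have "4 * real q * (2 * exp 5) = 8 * exp 5 * real q" by simp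
    then show ?thesis by (simp only: power_mult_distrib[symmetric])
  qed
  finally show ?thesis .
qed

text \<open>
  The factors come from \<open>spectral_norm_power_le_grid\<close>, from the number of pairs of points of the
  grid in dimension \<open>4q\<close>, and from the moments of the bilinear form.
\<close>

definition dense_norm_const :: real where
  "dense_norm_const = 4 * (2 ^ 27) ^ 8 * (8 * exp 5)"

text \<open>
  The maximum over pairs of grid points is bounded by the sum. In dimension \<open>4q\<close> the number of pairs
  is exponential in \<open>q\<close>, which a moment of order \<open>2q\<close> absorbs into the constant.
\<close>

lemma expectation_dense_spectral_norm_power:
  assumes q: "q \<ge> 1"
  shows "measure_pmf.expectation (edge_pmf (4 * q) (\<lambda>_ _. 1 / 3))
      (\<lambda>X. spectral_norm (4 * q) (centered (\<lambda>_ _. 1 / 3) X) ^ (2 * q)) \<le> (dense_norm_const * real q) ^ q"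
proof -
  let ?r = "4 * q" and ?p = "\<lambda>_ _. 1 / 3 :: real"
  let ?E = "measure_pmf.expectation (edge_pmf ?r ?p)"
  let ?b = "\<lambda>X x y. bilinear ?r (centered ?p X) x y"
  let ?G = "real (card (grid ?r))"
  have "?E (\<lambda>X. spectral_norm ?r (centered ?p X) ^ (2 * q))
      \<le> ?E (\<lambda>X. 4 ^ q * (\<Sum>x\<in>grid ?r. \<Sum>y\<in>grid ?r. ?b X x y ^ (2 * q)))"
    unfolding bilinear_def using q by (intro integral_mono spectral_norm_power_le_grid) auto
  also have "\<dots> = 4 ^ q * (\<Sum>x\<in>grid ?r. \<Sum>y\<in>grid ?r. ?E (\<lambda>X. ?b X x y ^ (2 * q)))"
    by (simp add: Bochner_Integration.integral_sum)
  also have "\<dots> \<le> 4 ^ q * (\<Sum>x\<in>grid ?r. \<Sum>y\<in>grid ?r. (8 * exp 5 * real q) ^ q)"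
    using q by (intro mult_left_mono sum_mono expectation_bilinear_power L2_set_grid_le) auto
  also have "\<dots> = 4 ^ q * (?G * ?G) * (8 * exp 5 * real q) ^ q"
    by simp
  also have "\<dots> \<le> 4 ^ q * ((2 ^ 27) ^ ?r * (2 ^ 27) ^ ?r) * (8 * exp 5 * real q) ^ q"
    by (intro mult_right_mono mult_left_mono mult_mono card_grid_le) auto
  also have "(2 ^ 27) ^ ?r * (2 ^ 27) ^ ?r = (((2::real) ^ 27) ^ 8) ^ q"
    unfolding power_add[symmetric] power_mult[symmetric] by simp
  also have "4 ^ q * (((2::real) ^ 27) ^ 8) ^ q * (8 * exp 5 * real q) ^ q = (dense_norm_const * real q) ^ q"
    unfolding dense_norm_const_def power_mult_distrib[symmetric] by (simp only: mult.assoc)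
  finally show ?thesis .
qed

section \<open>Moments of the norm, and the expectation\<close>

text \<open>
  The chain of comparisons: norm, trace, weighted walks in the given graph, number of walks on
  \<open>4q\<close> vertices, trace and norm of the dense matrix. The size \<open>4q\<close> leaves room for
  \<open>D = q\<close> beyond the \<open>2q + 1\<close> positions of the walk.
\<close>

lemma expectation_spectral_norm_power_le:
  assumes P: "\<And>i j. i \<in> {1..n} \<Longrightarrow> j \<in> {1..n} \<Longrightarrow> 0 \<le> p i j \<and> p i j \<le> 1 \<and> p i j = p j i"
    and D: "\<And>j. j \<in> {1..n} \<Longrightarrow> (\<Sum>i=1..n. p i j) \<le> real q"
    and q: "q = 2 ^ k"
  shows "measure_pmf.expectation (edge_pmf n p) (\<lambda>X. spectral_norm n (centered p X) ^ (2 * q))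
    \<le> real n * (9 * dense_norm_const * real q) ^ q"
proof -
  let ?r = "4 * q" and ?t = "\<lambda>_ _. 1 / 3 :: real"
  have q1: "q \<ge> 1" using q by simp
  have "measure_pmf.expectation (edge_pmf n p) (\<lambda>X. spectral_norm n (centered p X) ^ (2 * q))
      \<le> measure_pmf.expectation (edge_pmf n p) (\<lambda>X. trace_pow n (centered p X) (2 * q))"
    unfolding q by (intro integral_mono spectral_norm_le_trace_pow centered_symmetric) auto
  also have "\<dots> \<le> (\<Sum>xs\<in>good_walks n (2 * q). discovery_weight p xs)"
    by (rule expectation_trace_pow_le[OF P])
  also have "\<dots> \<le> real n / real ?r * real (card (good_walks ?r (2 * q)))"
    using q1 P by (intro sum_discovery_weight_le_card_good_walks[OF _ D]) auto
  also have "\<dots> \<le> real n / real ?r * (3 ^ (2 * q) * (real ?r * (dense_norm_const * real q) ^ q))"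
  proof (rule mult_left_mono)
    have "measure_pmf.expectation (edge_pmf ?r ?t) (\<lambda>X. trace_pow ?r (centered ?t X) (2 * q))
        \<le> measure_pmf.expectation (edge_pmf ?r ?t) (\<lambda>X. real ?r * spectral_norm ?r (centered ?t X) ^ (2 * q))"
      by (intro integral_mono trace_pow_le_spectral_norm centered_symmetric) auto
    also have "\<dots> = real ?r * measure_pmf.expectation (edge_pmf ?r ?t) (\<lambda>X. spectral_norm ?r (centered ?t X) ^ (2 * q))"
      by simp
    also have "\<dots> \<le> real ?r * (dense_norm_const * real q) ^ q"
      by (intro mult_left_mono expectation_dense_spectral_norm_power q1) auto
    finally have "3 ^ (2 * q) * measure_pmf.expectation (edge_pmf ?r ?t) (\<lambda>X. trace_pow ?r (centered ?t X) (2 * q))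
        \<le> 3 ^ (2 * q) * (real ?r * (dense_norm_const * real q) ^ q)"
      by (rule mult_left_mono) simp
    with card_good_walks_le show "real (card (good_walks ?r (2 * q)))
        \<le> 3 ^ (2 * q) * (real ?r * (dense_norm_const * real q) ^ q)"
      by (rule order_trans)
  qed simp
  also have "\<dots> = real n * (9 * dense_norm_const * real q) ^ q"
  proof -
    have nine: "(3::real) ^ (2 * q) = 9 ^ q" by (simp add: power_mult)
    show ?thesis
      unfolding nine using q1 by (simp add: power_mult_distrib)
  qed
  finally show ?thesis .
qed
lemma inhom_random_graph_eq_map_edge_pmf:
  "inhom_random_graph n p = map_pmf (\<lambda>X. {(i, j). X (edge i j)}) (edge_pmf n p)"
  unfolding inhom_random_graph_def edge_pmf_def pairs_def edge_def ..

lemma expectation_inhom_random_graph_spectral_norm: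
  assumes P: "\<forall>i\<in>{1..n}. \<forall>j\<in>{1..n}. 0 \<le> p i j \<and> p i j \<le> 1 \<and> p i j = p j i"
  shows "measure_pmf.expectation (inhom_random_graph n p)
      (\<lambda>G. spectral_norm n (\<lambda>i j. adjacency G i j - mean_adjacency n p i j))
    = measure_pmf.expectation (edge_pmf n p) (\<lambda>X. spectral_norm n (centered p X))"
proof -
  have "spectral_norm n (\<lambda>i j. adjacency {(i, j). X (edge i j)} i j - mean_adjacency n p i j)
      = spectral_norm n (centered p X)" for X
  proof (rule spectral_norm_cong)
    fix i j assume ij: "i \<in> {1..n}" "j \<in> {1..n}"
    have "case_prod p (edge i j) = p i j"
      using P ij by (auto simp: edge_def min_def max_def)
    then show "adjacency {(i, j). X (edge i j)} i j - mean_adjacency n p i j = centered p X i j"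
      using mean_adjacency_eq[OF P ij] by (simp add: adjacency_def centered_def)
  qed
  then show ?thesis
    unfolding inhom_random_graph_eq_map_edge_pmf by simp
qed

text \<open>
  This passes from a high moment to the expectation: if the \<open>m\<close>-th moment of \<open>z\<close> is at most \<open>a\<^sup>m\<close>,
  then its mean is at most \<open>2a\<close>.
\<close>

lemma le_add_power_div:
  fixes a z :: real
  assumes "a > 0" "z \<ge> 0" "m \<ge> 1"
  shows "z \<le> a + a * (z / a) ^ m"
proof (cases "z \<le> a")
  case True
  then show ?thesis using assms by (simp add: add_increasing2)
next
  case False
  then have "z / a \<ge> 1" using assms by simp
  then have "z / a \<le> (z / a) ^ m" using \<open>m \<ge> 1\<close> by (intro self_le_power) auto
  then have "a * (z / a) \<le> a * (z / a) ^ m" using assms by (intro mult_left_mono) auto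
  then show ?thesis using assms by simp
qed

lemma power_two_between:
  fixes m :: real
  assumes "m \<ge> 1"
  obtains k :: nat where "m \<le> 2 ^ k" "2 ^ k \<le> 2 * m"
proof -
  define k where "k = (LEAST k. m \<le> 2 ^ k)"
  have "\<exists>k. m \<le> 2 ^ k"
    using real_arch_pow[of 2 m] less_imp_le by auto
  then have k: "m \<le> 2 ^ k" unfolding k_def by (rule LeastI_ex)
  have "(2::real) ^ k \<le> 2 * m"
  proof (cases k)
    case 0
    then show ?thesis using assms by simp
  next
    case (Suc l)
    then have "\<not> m \<le> 2 ^ l" using not_less_Least[of l "\<lambda>k. m \<le> 2 ^ k"] by (simp add: k_def)
    then show ?thesis using Suc by simp
  qed
  with k that show ?thesis by blast
qed

text \<open>
  The factor \<open>9\<^sup>q = 3\<^sup>2\<^sup>q\<close> is lost in \<open>card_good_walks_le\<close>, and \<open>e\<^sup>q\<close> bounds the dimension \<open>n\<close>.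
\<close>

definition norm_const :: real where
  "norm_const = exp 1 * (9 * dense_norm_const)"

lemma norm_const_ge_1: "norm_const \<ge> 1"
proof -
  have "1 \<le> exp (1::real)" "1 \<le> exp (5::real)" by auto
  then have "1 * (9 * (4 * (2 ^ 27) ^ 8 * (8 * 1))) \<le> norm_const"
    unfolding norm_const_def dense_norm_const_def by (intro mult_mono) auto
  then show ?thesis by simp
qed

lemma expectation_spectral_norm_le_sqrt:
  assumes P: "\<And>i j. i \<in> {1..n} \<Longrightarrow> j \<in> {1..n} \<Longrightarrow> 0 \<le> p i j \<and> p i j \<le> 1 \<and> p i j = p j i"
    and D: "\<And>j. j \<in> {1..n} \<Longrightarrow> (\<Sum>i=1..n. p i j) \<le> real q"
    and q: "q = 2 ^ k" and n: "n \<ge> 1" "ln (real n) \<le> real q"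
  shows "measure_pmf.expectation (edge_pmf n p) (\<lambda>X. spectral_norm n (centered p X))
    \<le> 2 * sqrt (norm_const * real q)"
proof -
  let ?E = "measure_pmf.expectation (edge_pmf n p)"
  let ?S = "\<lambda>X. spectral_norm n (centered p X)"
  define a where "a = sqrt (norm_const * real q)"
  have pos: "norm_const * real q > 0" using norm_const_ge_1 q by simp
  then have a: "a > 0" by (simp add: a_def)
  have a_pow: "a ^ (2 * q) = (norm_const * real q) ^ q"
    using pos by (simp add: a_def power_mult)
  have "real n = exp (ln (real n))" using n by simp
  also have "\<dots> \<le> exp (real q)" by (simp only: exp_le_cancel_iff n)
  also have "exp (real q) = exp 1 ^ q"
    using exp_of_nat_mult[of q "1::real"] by simp
  finally have n_le: "real n \<le> exp 1 ^ q" .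
  have "?E (\<lambda>X. ?S X ^ (2 * q)) \<le> real n * (9 * dense_norm_const * real q) ^ q"
    by (rule expectation_spectral_norm_power_le[OF P D q])
  also have "\<dots> \<le> exp 1 ^ q * (9 * dense_norm_const * real q) ^ q"
    by (intro mult_right_mono n_le) (auto simp: dense_norm_const_def)
  also have "\<dots> = a ^ (2 * q)"
    unfolding a_pow norm_const_def power_mult_distrib[symmetric] by (simp only: mult.assoc)
  finally have moment: "?E (\<lambda>X. ?S X ^ (2 * q)) \<le> a ^ (2 * q)" .
  have "?E ?S \<le> ?E (\<lambda>X. a + a * (?S X / a) ^ (2 * q))"
    using a q by (intro integral_mono le_add_power_div spectral_norm_nonneg) auto
  also have "\<dots> = a + a / a ^ (2 * q) * ?E (\<lambda>X. ?S X ^ (2 * q))"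
    by (simp add: power_divide)
  also have "\<dots> \<le> a + a / a ^ (2 * q) * a ^ (2 * q)"
    using a by (intro add_left_mono mult_left_mono moment) auto
  also have "\<dots> = 2 * a" using a by simp
  finally show ?thesis by (simp add: a_def)
qed

text \<open>
  Here \<open>log n = 0\<close>, and the bound has to tend to zero with \<open>p\<close>. The mean of \<open>|b - p|\<close> is at most
  \<open>2p\<close>, and \<open>p \<le> \<surd>p\<close>.
\<close>

lemma expectation_spectral_norm_single_vertex:
  assumes "0 \<le> p 1 1" "p 1 1 \<le> 1"
  shows "measure_pmf.expectation (edge_pmf 1 p) (\<lambda>X. spectral_norm 1 (centered p X)) \<le> 2 * sqrt (p 1 1)"
proof -
  have pairs: "pairs 1 = {(1, 1)}" by (auto simp: pairs_def)
  have "spectral_norm 1 (centered p X) \<le> of_bool (X (1, 1)) + p 1 1" for X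
  proof (rule spectral_norm_leI)
    fix x :: "nat \<Rightarrow> real" assume "L2_set x {1..1} \<le> 1"
    then have "L2_set (mat_vec 1 (centered p X) x) {1..1} \<le> (\<Sum>i=1..1. \<Sum>j=1..1. \<bar>centered p X i j\<bar>)"
      by (rule L2_set_mat_vec_le_sum_abs)
    also have "\<dots> = \<bar>of_bool (X (1, 1)) - p 1 1\<bar>"
      by (simp add: centered_def edge_def)
    also have "\<dots> \<le> of_bool (X (1, 1)) + p 1 1"
      using assms by (auto simp: of_bool_def)
    finally show "L2_set (mat_vec 1 (centered p X) x) {1..1} \<le> of_bool (X (1, 1)) + p 1 1" .
  qed
  then have "measure_pmf.expectation (edge_pmf 1 p) (\<lambda>X. spectral_norm 1 (centered p X))
      \<le> measure_pmf.expectation (edge_pmf 1 p) (\<lambda>X. of_bool (X (1, 1)) + p 1 1)"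
    by (intro integral_mono) auto
  also have "\<dots> = measure_pmf.expectation (edge_pmf 1 p) (\<lambda>X. \<Prod>e\<in>pairs 1. of_bool (X e)) + p 1 1"
    unfolding pairs by simp
  also have "\<dots> = 2 * p 1 1"
    using expectation_edge_pmf_prod[of 1 p "\<lambda>e b. of_bool b"] assms unfolding pairs by simp
  also have "\<dots> \<le> 2 * sqrt (p 1 1)"
  proof -
    have "(p 1 1)\<^sup>2 \<le> p 1 1"
      using assms by (simp add: power2_eq_square mult_left_le)
    then show ?thesis using assms by (simp add: real_le_rsqrt)
  qed
  finally show ?thesis .
qed

theorem proposition4p1:
  shows "\<exists>C::real. C > 0 \<and>
    (\<forall>(n::nat) (p :: nat \<Rightarrow> nat \<Rightarrow> real).
       n \<ge> 1 \<longrightarrow>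
       (\<forall>i\<in>{1..n}. \<forall>j\<in>{1..n}. 0 \<le> p i j \<and> p i j \<le> 1 \<and> p i j = p j i) \<longrightarrow>
       measure_pmf.expectation (inhom_random_graph n p)
         (\<lambda>G. spectral_norm n (\<lambda>i j. adjacency G i j - mean_adjacency n p i j))
       \<le> C * (sqrt (max_expected_degree n p) + sqrt (ln (real n))))"
proof (intro exI[of _ "4 * sqrt norm_const"] conjI allI impI)
  show "0 < 4 * sqrt norm_const" using norm_const_ge_1 by simp
next
  fix n :: nat and p :: "nat \<Rightarrow> nat \<Rightarrow> real"
  assume n: "n \<ge> 1"
    and P: "\<forall>i\<in>{1..n}. \<forall>j\<in>{1..n}. 0 \<le> p i j \<and> p i j \<le> 1 \<and> p i j = p j i"
  let ?E = "measure_pmf.expectation (edge_pmf n p) (\<lambda>X. spectral_norm n (centered p X))"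
  let ?d = "max_expected_degree n p"
  have row: "(\<Sum>j=1..n. p i j) \<le> ?d" if "i \<in> {1..n}" for i
    unfolding max_expected_degree_def using that by (intro Max_ge) auto
  have col: "(\<Sum>i=1..n. p i j) \<le> ?d" if "j \<in> {1..n}" for j
  proof -
    have "(\<Sum>i=1..n. p i j) = (\<Sum>i=1..n. p j i)"
      using P that by (intro sum.cong) auto
    then show ?thesis using row[OF that] by simp
  qed
  have "0 \<le> (\<Sum>j=1..n. p 1 j)" using P n by (intro sum_nonneg) auto
  then have d: "0 \<le> ?d" using row[of 1] n by simp
  have "?E \<le> 4 * sqrt norm_const * (sqrt ?d + sqrt (ln (real n)))"
  proof (cases "n = 1")
    case True
    have p11: "0 \<le> p 1 1" "p 1 1 \<le> 1" using P n by auto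
    have "?E \<le> 2 * sqrt (p 1 1)"
      using expectation_spectral_norm_single_vertex[of p] p11 True by simp
    also have "\<dots> \<le> 4 * sqrt norm_const * sqrt ?d"
    proof (rule mult_mono)
      show "2 \<le> 4 * sqrt norm_const"
        using real_sqrt_ge_one[OF norm_const_ge_1] by linarith
      show "sqrt (p 1 1) \<le> sqrt ?d"
        using row[of 1] True by simp
    qed (use p11 norm_const_ge_1 in auto)
    finally show ?thesis using True by simp
  next
    case False
    with n have "n \<ge> 2" by simp
    \<comment> \<open>A lower bound on \<open>ln n\<close> lets \<open>2 ln n\<close> absorb the \<open>1\<close> in the maximum defining \<open>m\<close>.\<close>
    then have "exp (1 / 2) \<le> real n"
    proof -
      have "exp (1 / 2 :: real) \<le> 1 + 1 / 2 + (1 / 2)\<^sup>2" by (rule exp_bound) auto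
      also have "\<dots> \<le> 2" by (simp add: power2_eq_square)
      finally show ?thesis using \<open>n \<ge> 2\<close> by simp
    qed
    then have "ln (exp (1 / 2)) \<le> ln (real n)"
      using n by (intro iffD2[OF ln_le_cancel_iff]) auto
    then have ln: "1 / 2 \<le> ln (real n)" by simp
    define m where "m = max 1 (max ?d (ln (real n)))"
    obtain k :: nat where k: "m \<le> 2 ^ k" "2 ^ k \<le> 2 * m"
      using power_two_between[of m] by (auto simp: m_def)
    define q :: nat where "q = 2 ^ k"
    have q: "m \<le> real q" "real q \<le> 2 * m" using k by (simp_all add: q_def)
    have "?E \<le> 2 * sqrt (norm_const * real q)"
    proof (rule expectation_spectral_norm_le_sqrt[OF _ _ q_def n])
      show "(\<Sum>i=1..n. p i j) \<le> real q" if "j \<in> {1..n}" for j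
        using col[OF that] q(1) by (simp add: m_def)
    qed (use P q(1) in \<open>auto simp: m_def\<close>)
    also have "\<dots> \<le> 2 * sqrt (norm_const * (4 * (?d + ln (real n))))"
    proof -
      have "real q \<le> 4 * (?d + ln (real n))"
        using q(2) d ln by (simp add: m_def max_def split: if_splits)
      then show ?thesis using norm_const_ge_1 by (intro mult_left_mono real_sqrt_le_mono) auto
    qed
    also have "\<dots> = 4 * sqrt norm_const * sqrt (?d + ln (real n))"
      unfolding real_sqrt_mult by simp
    also have "\<dots> \<le> 4 * sqrt norm_const * (sqrt ?d + sqrt (ln (real n)))"
      using d ln norm_const_ge_1 by (intro mult_left_mono sqrt_add_le_add_sqrt) auto
    finally show ?thesis .
  qed
  then show "measure_pmf.expectation (inhom_random_graph n p)
         (\<lambda>G. spectral_norm n (\<lambda>i j. adjacency G i j - mean_adjacency n p i j))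
       \<le> 4 * sqrt norm_const * (sqrt (max_expected_degree n p) + sqrt (ln (real n)))"
    unfolding expectation_inhom_random_graph_spectral_norm[OF P] .
qed

end
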